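(* There exist absolute constants $C_1,C_2>0$ such that the following holds. Let $f:\mathbb{R}^n\to\mathbb{R}$ be a differentiable convex function that is $\beta$-smooth and $\alpha$-strongly convex ($\beta,\alpha>0$), with condition number $\kappa=\beta/\alpha$, let $s\ge 1$ be an integer, let $x^*\in\mathbb{R}^n$ be any (unknown) $s$-sparse vector, and let $\varepsilon>0$. Put $s'=\lceil C_1 s\kappa\rceil$, let $x^0\in\mathbb{R}^n$ be an arbitrary $s'$-sparse vector, and put $$T=\max\left\{1,\left\lceil C_2\,\kappa\,\log\frac{f(x^0)+(\beta/2)\|x^0\|_2^2-f(x^* )}{\varepsilon}\right\rceil\right\}$$ (with $T=1$ if $f(x^0)+(\beta/2)\|x^0\|_2^2-f(x^* )\le\varepsilon$). Then the Regularized IHT algorithm (defined in the context), run for $T$ iterations from $x^0$ with sparsity level $s'$, step size $\eta=(2\beta)^{-1}$ and weight step size $c=s'/(4T)$, returns an $s'$-sparse vector $x^T$ with $$f(x^T)\le f(x^* )+\varepsilon .$$ Furthermore, each iteration requires $O(1)$ evaluations of $f$ and $\nabla f$, and $O(n)$ additional time.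
   Context: A vector is $s$-sparse if it has at most $s$ non-zero entries. A differentiable $f$ is $\beta$-smooth if $f(y)\le f(x)+\langle\nabla f(x),y-x\rangle+(\beta/2)\|y-x\|_2^2$ for all $x,y$, and $\alpha$-strongly convex if $f(y)\ge f(x)+\langle\nabla f(x),y-x\rangle+(\alpha/2)\|y-x\|_2^2$ for all $x,y$. Notation: products and squares of vectors are entrywise; $\mathbf 1$ is the all-ones vector; for $w\ge 0$, $\|x\|_{w,2}^2=\sum_i w_i x_i^2$. $H_{s'}(x)$ keeps the $s'$ entries of $x$ of largest absolute value (ties broken arbitrarily) and sets all other entries to $0$ (it is the identity if $s'\ge n$). For a vector $v$, $(v)_{\ge 1/2}$ is the vector obtained from $v$ by setting to $0$ every entry smaller than $1/2$. Regularized IHT algorithm (inputs $x^0$, $s'$, $\eta$, $c$, $T$). Set $w^0=\mathbf 1$. For $t=0,1,\dots,T-1$: 1. $x^{t+1}=H_{s'}\big((\mathbf 1-0.5\,w^t)x^t-\eta\nabla f(x^t)\big)$. 2. $w^{t+1}=\big(w^t-c\,(w^tx^t)^2/\|x^t\|_{w^t,2}^2\big)_{\ge 1/2}$ (with $w^{t+1}=w^t$ if $\|x^t\|_{w^t,2}=0$). 3. If $f(x^{t+1})+(4\eta)^{-1}\|x^{t+1}\|_{w^{t+1},2}^2>f(x^t)+(4\eta)^{-1}\|x^t\|_{w^{t+1},2}^2$, then reset $x^{t+1}=x^t$. Return $x^T$. *)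

theory Defs
  imports Complex_Main "Jordan_Normal_Form.Matrix"
begin

(* The constants of the theorem are uniform in the dimension n, so n must be quantified inside
   the statement.  Points of R^n are therefore elements of carrier_vec n, and an objective
   f :: real vec => real is only ever considered on carrier_vec n. *)

definition norm2 :: "real vec \<Rightarrow> real" where
  "norm2 v = sqrt (scalar_prod v v)"

definition sparse :: "nat \<Rightarrow> real vec \<Rightarrow> bool" where
  "sparse k v \<longleftrightarrow> card {i. i < dim_vec v \<and> v $ i \<noteq> 0} \<le> k"


subsection \<open>Differentiability, smoothness, convexity\<close>

(* Frechet differentiability at x, the derivative being represented by the vector g. *)
definition has_gradient :: "nat \<Rightarrow> (real vec \<Rightarrow> real) \<Rightarrow> real vec \<Rightarrow> real vec \<Rightarrow> bool" where
  "has_gradient n f g x \<longleftrightarrow> g \<in> carrier_vec n \<and>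
     (\<forall>e>0. \<exists>d>0. \<forall>y\<in>carrier_vec n. norm2 (y - x) < d \<longrightarrow>
        \<bar>f y - f x - scalar_prod g (y - x)\<bar> \<le> e * norm2 (y - x))"

definition vec_differentiable :: "nat \<Rightarrow> (real vec \<Rightarrow> real) \<Rightarrow> bool" where
  "vec_differentiable n f \<longleftrightarrow> (\<forall>x\<in>carrier_vec n. \<exists>g. has_gradient n f g x)"

definition gradient :: "nat \<Rightarrow> (real vec \<Rightarrow> real) \<Rightarrow> real vec \<Rightarrow> real vec" where
  "gradient n f x = (THE g. has_gradient n f g x)"

definition smooth :: "nat \<Rightarrow> real \<Rightarrow> (real vec \<Rightarrow> real) \<Rightarrow> bool" where
  "smooth n \<beta> f \<longleftrightarrow> (\<forall>x\<in>carrier_vec n. \<forall>y\<in>carrier_vec n.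
     f y \<le> f x + scalar_prod (gradient n f x) (y - x) + \<beta> / 2 * (norm2 (y - x))\<^sup>2)"

definition strongly_convex :: "nat \<Rightarrow> real \<Rightarrow> (real vec \<Rightarrow> real) \<Rightarrow> bool" where
  "strongly_convex n \<alpha> f \<longleftrightarrow> (\<forall>x\<in>carrier_vec n. \<forall>y\<in>carrier_vec n.
     f y \<ge> f x + scalar_prod (gradient n f x) (y - x) + \<alpha> / 2 * (norm2 (y - x))\<^sup>2)"

definition vec_convex :: "nat \<Rightarrow> (real vec \<Rightarrow> real) \<Rightarrow> bool" where
  "vec_convex n f \<longleftrightarrow> (\<forall>x\<in>carrier_vec n. \<forall>y\<in>carrier_vec n. \<forall>u. 0 \<le> u \<and> u \<le> 1 \<longrightarrow>
     f ((1 - u) \<cdot>\<^sub>v x + u \<cdot>\<^sub>v y) \<le> (1 - u) * f x + u * f y)"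


subsection \<open>Regularized IHT\<close>

(* A relation rather than a function: ties are broken arbitrarily, so S is any admissible
   choice of the k positions to keep (all positions if k is at least the dimension). *)
definition hard_threshold :: "nat \<Rightarrow> real vec \<Rightarrow> real vec \<Rightarrow> bool" where
  "hard_threshold k z y \<longleftrightarrow> (\<exists>S \<subseteq> {..<dim_vec z}.
     card S = min k (dim_vec z) \<and>
     (\<forall>i\<in>S. \<forall>j\<in>{..<dim_vec z} - S. \<bar>z $ j\<bar> \<le> \<bar>z $ i\<bar>) \<and>
     y = vec (dim_vec z) (\<lambda>i. if i \<in> S then z $ i else 0))"

(* the squared weighted norm *)
definition wnorm_sq :: "real vec \<Rightarrow> real vec \<Rightarrow> real" where
  "wnorm_sq w x = (\<Sum>i<dim_vec x. w $ i * (x $ i)\<^sup>2)"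

definition threshold_half :: "real vec \<Rightarrow> real vec" where
  "threshold_half v = map_vec (\<lambda>a. if a < 1 / 2 then 0 else a) v"

definition update_weights :: "real \<Rightarrow> real vec \<Rightarrow> real vec \<Rightarrow> real vec" where
  "update_weights c x w =
     (if wnorm_sq w x = 0 then w
      else threshold_half (vec (dim_vec w) (\<lambda>i. w $ i - c * (w $ i * x $ i)\<^sup>2 / wnorm_sq w x)))"

(* One iteration, from the state (x, w) to the state (x', w').  The weights w' are kept even
   if the new iterate y is rejected. *)
definition riht_step ::
  "nat \<Rightarrow> (real vec \<Rightarrow> real) \<Rightarrow> nat \<Rightarrow> real \<Rightarrow> real \<Rightarrow> real vec \<Rightarrow> real vec \<Rightarrow> real vec \<Rightarrow> real vec \<Rightarrow> bool"
where
  "riht_step n f s' \<eta> c x w x' w' \<longleftrightarrow> (\<exists>y.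
     hard_threshold s' (vec n (\<lambda>i. (1 - 0.5 * w $ i) * x $ i - \<eta> * gradient n f x $ i)) y \<and>
     w' = update_weights c x w \<and>
     x' = (if f y + 1 / (4 * \<eta>) * wnorm_sq w' y > f x + 1 / (4 * \<eta>) * wnorm_sq w' x
           then x else y))"

definition riht_run ::
  "nat \<Rightarrow> (real vec \<Rightarrow> real) \<Rightarrow> nat \<Rightarrow> real \<Rightarrow> real \<Rightarrow> nat \<Rightarrow> real vec \<Rightarrow>
   (nat \<Rightarrow> real vec) \<Rightarrow> (nat \<Rightarrow> real vec) \<Rightarrow> bool"
where
  "riht_run n f s' \<eta> c T x0 X W \<longleftrightarrow>
     X 0 = x0 \<and> W 0 = vec n (\<lambda>_. 1) \<and>
     (\<forall>t<T. riht_step n f s' \<eta> c (X t) (W t) (X (Suc t)) (W (Suc t)))"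


subsection \<open>A real-number machine with oracle access to a function and its gradient\<close>

(* The cost model is a first-order call-by-value language over binary trees with real leaves.
   Every evaluated construct costs one unit of time, as in the real RAM model (to which it
   compiles with constant-factor overhead); there is no rounding operation with which several
   data items could be unpacked from one real.  Variables are de Bruijn indices into a list
   of values; a procedure has one argument, several arguments being passed as a tree.  A query
   of an oracle takes and returns a pointer to its data, hence costs one unit of time apart
   from the evaluation of its argument, and is in addition counted as a query. *)

datatype val = VNil | VNum real | VCons val val

datatype arith = Plus | Minus | Times | Divide

fun arith_op :: "arith \<Rightarrow> real \<Rightarrow> real \<Rightarrow> real" where
  "arith_op Plus a b = a + b"
| "arith_op Minus a b = a - b"
| "arith_op Times a b = a * b"
| "arith_op Divide a b = a / b"

datatype expr =
    Var nat
  | Lit int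
  | Arith arith expr expr
  | NilE
  | ConsE expr expr
  | CarE expr
  | CdrE expr
  | IfLess expr expr expr expr
  | IfNil expr expr expr
  | LetE expr expr
  | Call nat expr
  | EvalF expr
  | EvalGrad expr

definition encode_vec :: "real vec \<Rightarrow> val" where
  "encode_vec v = foldr (\<lambda>a. VCons (VNum a)) (list_of_vec v) VNil"

(* exec P n f g env e v p q t: with procedure bodies P and oracles f and g on R^n, the
   expression e evaluates in env to v with p queries of f, q queries of g, in time t. *)
inductive exec ::
  "expr list \<Rightarrow> nat \<Rightarrow> (real vec \<Rightarrow> real) \<Rightarrow> (real vec \<Rightarrow> real vec) \<Rightarrow>
   val list \<Rightarrow> expr \<Rightarrow> val \<Rightarrow> nat \<Rightarrow> nat \<Rightarrow> nat \<Rightarrow> bool"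
  for P :: "expr list" and n :: nat and f :: "real vec \<Rightarrow> real" and g :: "real vec \<Rightarrow> real vec"
where
  Var: "i < length env \<Longrightarrow> exec P n f g env (Var i) (env ! i) 0 0 1"
| Lit: "exec P n f g env (Lit k) (VNum (of_int k)) 0 0 1"
| Arith: "exec P n f g env e1 (VNum a) p1 q1 t1 \<Longrightarrow> exec P n f g env e2 (VNum b) p2 q2 t2 \<Longrightarrow>
    exec P n f g env (Arith bop e1 e2) (VNum (arith_op bop a b)) (p1 + p2) (q1 + q2) (t1 + t2 + 1)"
| NilE: "exec P n f g env NilE VNil 0 0 1"
| ConsE: "exec P n f g env e1 u p1 q1 t1 \<Longrightarrow> exec P n f g env e2 v p2 q2 t2 \<Longrightarrow>
    exec P n f g env (ConsE e1 e2) (VCons u v) (p1 + p2) (q1 + q2) (t1 + t2 + 1)"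
| CarE: "exec P n f g env e (VCons u v) p q t \<Longrightarrow> exec P n f g env (CarE e) u p q (t + 1)"
| CdrE: "exec P n f g env e (VCons u v) p q t \<Longrightarrow> exec P n f g env (CdrE e) v p q (t + 1)"
| IfLess: "exec P n f g env e1 (VNum a) p1 q1 t1 \<Longrightarrow> exec P n f g env e2 (VNum b) p2 q2 t2 \<Longrightarrow>
    exec P n f g env (if a < b then e3 else e4) v p3 q3 t3 \<Longrightarrow>
    exec P n f g env (IfLess e1 e2 e3 e4) v (p1 + p2 + p3) (q1 + q2 + q3) (t1 + t2 + t3 + 1)"
| IfNil: "exec P n f g env e1 u p1 q1 t1 \<Longrightarrow>
    exec P n f g env (if u = VNil then e2 else e3) v p2 q2 t2 \<Longrightarrow>
    exec P n f g env (IfNil e1 e2 e3) v (p1 + p2) (q1 + q2) (t1 + t2 + 1)"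
| LetE: "exec P n f g env e1 u p1 q1 t1 \<Longrightarrow> exec P n f g (u # env) e2 v p2 q2 t2 \<Longrightarrow>
    exec P n f g env (LetE e1 e2) v (p1 + p2) (q1 + q2) (t1 + t2 + 1)"
| Call: "k < length P \<Longrightarrow> exec P n f g env e u p1 q1 t1 \<Longrightarrow> exec P n f g [u] (P ! k) v p2 q2 t2 \<Longrightarrow>
    exec P n f g env (Call k e) v (p1 + p2) (q1 + q2) (t1 + t2 + 1)"
| EvalF: "exec P n f g env e (encode_vec x) p q t \<Longrightarrow> x \<in> carrier_vec n \<Longrightarrow>
    exec P n f g env (EvalF e) (VNum (f x)) (p + 1) q (t + 1)"
| EvalGrad: "exec P n f g env e (encode_vec x) p q t \<Longrightarrow> x \<in> carrier_vec n \<Longrightarrow>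
    exec P n f g env (EvalGrad e) (encode_vec (g x)) p (q + 1) (t + 1)"

(* The program (P, main) carries out one iteration from the state (x, w) with at most K queries
   of f, at most K queries of the gradient of f, and in additional time at most K n. *)
definition iteration_cost_le ::
  "expr list \<Rightarrow> expr \<Rightarrow> nat \<Rightarrow> nat \<Rightarrow> (real vec \<Rightarrow> real) \<Rightarrow> nat \<Rightarrow> real \<Rightarrow> real \<Rightarrow>
   real vec \<Rightarrow> real vec \<Rightarrow> bool"
where
  "iteration_cost_le P main K n f s' \<eta> c x w \<longleftrightarrow> (\<exists>x' w' p q t.
     exec P n f (gradient n f)
       [encode_vec x, encode_vec w, VNum (real s'), VNum \<eta>, VNum c] main
       (VCons (encode_vec x') (encode_vec w')) p q t \<and>
     riht_step n f s' \<eta> c x w x' w' \<and>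
     p \<le> K \<and> q \<le> K \<and> t \<le> K * n)"

end

(*
Write kappa = beta / alpha, g_w(x) = f(x) + (beta/2) |x|^2_w and Delta = g_w(x) - f(xs), and let A
be the support of xs.  An iteration is a thresholded gradient step of length 1/(2 beta) for the
2 beta-smooth function g_w.  It is compared with a step of relative length 1/(4 kappa) towards xs in
which the smallest entries among the coordinates outside A of positive weight are sacrificed to
meet the sparsity constraint; at most s'/2 coordinates ever get weight zero, so at least
128 s kappa such coordinates are available and the sacrifice is paid for by the regularizer.  This
contracts Delta by a factor 1 - 1/(16 kappa) unless the correlation of the regularizer with xs - x
is too large, that is, unless A carries a fraction of order 1/kappa of the weighted norm.  In that
case the weight update either lowers the total weight of A by at least c/(24 kappa), which can
happen at most T/2 times, or sets weights of A to zero and thereby contracts Delta by a factor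
1 - 1/(24 kappa).

For the running time the threshold is found by selection with medians of medians.  Medians of groups
of three are taken twice, which makes the pivot discard two ninths of the list, so that the sizes n/9
and 7n/9 of the two recursive calls add up to less than n.
*)
theory Submission
  imports Defs
begin

section \<open>Convergence\<close>

text \<open>Cutting weights off at 1/2 makes w, w^2 and 1 comparable wherever a weight is positive.
  This is used twice: x^2 \<le> 2 w x^2 lets the regularizer pay for sacrificed entries, and w \<le>
  2 w^2 bounds the regularizer on A by the sum M of (w x)^2 over A. The weight update subtracts
  multiples of these same terms (w x)^2, so a large M, which is what spoils the correlation, also
  forces the update to act on A. Contracting and stalled iterations are not counted separately. The
  weight that A has lost, divided by c, is carried along in the exponent of the bound on Delta, and
  stalled iterations are charged to it. In the selection, medians of three taken only once would
  give recursive calls of sizes n/3 and 2n/3, whose sum n leaves no room for the linear work. The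
  machine cannot round, so ranks are real numbers and half the length of a list is used directly as
  a rank.\<close>

lemma ex_smallest_subset:
  fixes h :: "'a \<Rightarrow> real"
  assumes "finite Q" "m \<le> card Q"
  shows "\<exists>R\<subseteq>Q. card R = m \<and> (\<forall>a\<in>R. \<forall>b\<in>Q - R. h a \<le> h b)"
  using assms(2)
proof (induction m)
  case 0
  then show ?case by (intro exI[of _ "{}"]) auto
next
  case (Suc m)
  then obtain R where R: "R \<subseteq> Q" "card R = m" "\<forall>a\<in>R. \<forall>b\<in>Q - R. h a \<le> h b"
    by auto
  have fR: "finite R" using R(1) assms(1) finite_subset by blast
  have "Q - R \<noteq> {}"
  proof
    assume "Q - R = {}"
    then have "Q = R" using R(1) by auto
    then show False using R(2) Suc.prems by simp
  qed
  then have "Min (h ` (Q - R)) \<in> h ` (Q - R)" using assms(1) by (intro Min_in) auto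
  then obtain q where q: "q \<in> Q - R" "h q = Min (h ` (Q - R))" by (metis imageE)
  have q_min: "\<forall>b\<in>Q - R. h q \<le> h b" unfolding q(2) using assms(1) by simp
  show ?case
    using R q(1) q_min fR by (intro exI[of _ "insert q R"]) auto
qed

text \<open>Both sides are double sums over all pairs from \<open>A\<close> and \<open>B\<close>.
  This compares averages with the denominators cleared, so that empty sets need no case
  distinction.\<close>

lemma card_weighted_sum_le:
  fixes h :: "'a \<Rightarrow> real"
  assumes "\<And>a b. a \<in> A \<Longrightarrow> b \<in> B \<Longrightarrow> h a \<le> h b"
  shows "real (card B) * sum h A \<le> real (card A) * sum h B"
proof -
  have "real (card B) * sum h A = (\<Sum>a\<in>A. \<Sum>b\<in>B. h a)"
    by (simp add: sum_distrib_left)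
  also have "\<dots> \<le> (\<Sum>a\<in>A. \<Sum>b\<in>B. h b)"
    by (intro sum_mono assms)
  finally show ?thesis by simp
qed

lemma sum_smallest_le:
  fixes h :: "'a \<Rightarrow> real"
  assumes "finite Q" "R \<subseteq> Q" "\<And>a b. a \<in> R \<Longrightarrow> b \<in> Q - R \<Longrightarrow> h a \<le> h b"
  shows "real (card Q) * sum h R \<le> real (card R) * sum h Q"
proof -
  have "real (card (Q - R)) * sum h R \<le> real (card R) * sum h (Q - R)"
    by (intro card_weighted_sum_le assms(3))
  moreover
  have "card Q = card (Q - R) + card R"
    using assms(1,2) card_Diff_subset[of R Q] card_mono[of Q R] finite_subset[of R Q] by simp
  then have "real (card Q) = real (card (Q - R)) + real (card R)" by simp
  moreover have "sum h Q = sum h (Q - R) + sum h R"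
    by (rule sum.subset_diff[OF assms(2,1)])
  ultimately show ?thesis by (simp add: algebra_simps)
qed

text \<open>Apart from the common part, \<open>S - A\<close> has at least as many elements as
  \<open>A - S\<close>, each with at least as large a value. Applied to squares, this is the
  optimality of hard thresholding against every support \<open>A\<close> of at most the same
  size.\<close>

lemma sum_outside_top_le:
  fixes h :: "'a \<Rightarrow> real"
  assumes "finite I" "S \<subseteq> I" "A \<subseteq> I" "card A \<le> card S"
    and top: "\<And>i j. i \<in> S \<Longrightarrow> j \<in> I - S \<Longrightarrow> h j \<le> h i"
    and nn: "\<And>i. i \<in> I \<Longrightarrow> 0 \<le> h i"
  shows "sum h (I - S) \<le> sum h (I - A)"
proof -
  have fin: "finite S" "finite A" using assms finite_subset by blast+
  have 1: "real (card (S - A)) * sum h (A - S) \<le> real (card (A - S)) * sum h (S - A)"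
    using top assms(3) by (intro card_weighted_sum_le) auto
  have 2: "card (A - S) \<le> card (S - A)"
    using assms(4) fin by (simp add: card_Diff_subset_Int Int_commute)
  have nn': "0 \<le> sum h (S - A)" using nn assms(2) by (intro sum_nonneg) auto
  have 3: "sum h (A - S) \<le> sum h (S - A)"
  proof (cases "card (S - A) = 0")
    case True
    then have "card (A - S) = 0" using 2 by linarith
    then have "A - S = {}" using fin by (metis card_0_eq finite_Diff)
    then show ?thesis using nn' by (metis sum.empty)
  next
    case False
    have "real (card (S - A)) * sum h (A - S) \<le> real (card (S - A)) * sum h (S - A)"
      using 1 2 nn' by (meson mult_right_mono of_nat_le_iff order_trans)
    then show ?thesis using False by simp
  qed
  have "I - S = (I - S - A) \<union> (A - S)" "I - A = (I - S - A) \<union> (S - A)" using assms by auto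
  moreover have "sum h ((I - S - A) \<union> (A - S)) = sum h (I - S - A) + sum h (A - S)"
    "sum h ((I - S - A) \<union> (S - A)) = sum h (I - S - A) + sum h (S - A)"
    using fin assms(1) by (intro sum.union_disjoint; auto)+
  ultimately show ?thesis using 3 by simp
qed

section \<open>A thresholded gradient step, coordinate by coordinate\<close>

text \<open>The set \<open>U - R\<close> competes with the kept set \<open>S\<close>: it covers the
  supports of \<open>x\<close> and \<open>d\<close> except for the sacrificed entries
  \<open>R\<close>. Half of the gain G^2/(4 \<beta>) on \<open>U\<close> is at least half the
  decrease of the quadratic model along \<open>\<theta> d\<close>, whatever \<open>\<theta>\<close>
  is; the other half absorbs the gradient part of the sacrificed squares.\<close>

lemma threshold_descent:
  fixes x y z d G :: "nat \<Rightarrow> real"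
  assumes fin: "finite I" and S: "S \<subseteq> I"
    and top: "\<And>i j. i \<in> S \<Longrightarrow> j \<in> I - S \<Longrightarrow> \<bar>z j\<bar> \<le> \<bar>z i\<bar>"
    and U: "U \<subseteq> I" and xU: "\<And>i. i \<in> I - U \<Longrightarrow> x i = 0" and dU: "\<And>i. i \<in> I - U \<Longrightarrow> d i = 0"
    and Q: "R \<subseteq> Q" "Q \<subseteq> U" and card: "card (U - R) \<le> card S"
    and z: "\<And>i. i \<in> I \<Longrightarrow> z i = x i - G i / (2 * \<beta>)"
    and y: "\<And>i. i \<in> I \<Longrightarrow> y i = (if i \<in> S then z i else 0)"
    and R: "(\<Sum>i\<in>R. (z i)\<^sup>2) \<le> \<rho> * (\<Sum>i\<in>Q. (z i)\<^sup>2)"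
    and \<rho>: "0 \<le> \<rho>" "\<rho> \<le> 1/4" and \<beta>: "\<beta> > 0"
  shows "(\<Sum>i\<in>I. G i * (y i - x i) + \<beta> * (y i - x i)\<^sup>2)
    \<le> 1/2 * (\<Sum>i\<in>I. \<theta> * (G i * d i) + \<beta> * \<theta>\<^sup>2 * (d i)\<^sup>2) + 2 * \<beta> * \<rho> * (\<Sum>i\<in>Q. (x i)\<^sup>2)"
proof -
  have finU: "finite U" "finite Q" "finite R" using U Q fin by (meson finite_subset)+
  \<comment> \<open>Completing the square: the model at \<open>y\<close> is \<beta> (y - z)^2 -
    G^2/(4 \<beta>), and y - z is either 0 or -z.\<close>
  have sq: "G i * (y i - x i) + \<beta> * (y i - x i)\<^sup>2
      = \<beta> * (if i \<in> S then 0 else (z i)\<^sup>2) - (G i)\<^sup>2 / (4 * \<beta>)" if "i \<in> I" for i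
    using \<beta> unfolding y[OF that] z[OF that] by (auto simp: field_simps power2_eq_square)
  have "(\<Sum>i\<in>I. G i * (y i - x i) + \<beta> * (y i - x i)\<^sup>2)
     = \<beta> * (\<Sum>i\<in>I. if i \<in> S then 0 else (z i)\<^sup>2) - (\<Sum>i\<in>I. (G i)\<^sup>2 / (4 * \<beta>))"
    by (simp add: sq sum_subtractf sum_distrib_left)
  also have "(\<Sum>i\<in>I. if i \<in> S then 0 else (z i)\<^sup>2) = (\<Sum>i\<in>I - S. (z i)\<^sup>2)"
    by (rule sum.mono_neutral_cong_right) (use fin in auto)
  also have "\<dots> \<le> (\<Sum>i\<in>I - (U - R). (z i)\<^sup>2)"
    using U by (intro sum_outside_top_le fin S card) (use top in \<open>auto simp: abs_le_square_iff[symmetric]\<close>)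
  also have "(\<Sum>i\<in>I - (U - R). (z i)\<^sup>2) = (\<Sum>i\<in>I - U. (z i)\<^sup>2) + (\<Sum>i\<in>R. (z i)\<^sup>2)"
  proof -
    have "I - (U - R) = (I - U) \<union> R" using Q U by auto
    moreover have "(I - U) \<inter> R = {}" using Q by auto
    ultimately show ?thesis using fin finU by (simp add: sum.union_disjoint)
  qed
  \<comment> \<open>Outside \<open>U\<close> the entries of \<open>x\<close> vanish, so \<beta> z^2
    is exactly the gain G^2/(4 \<beta>) there and the two cancel.\<close>
  also have "(\<Sum>i\<in>I - U. (z i)\<^sup>2) = (\<Sum>i\<in>I - U. (G i)\<^sup>2 / (4 * \<beta>)) / \<beta>"
    unfolding sum_divide_distrib
  proof (rule sum.cong)
    fix i assume "i \<in> I - U"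
    then have "z i = - (G i / (2 * \<beta>))" using z[of i] xU[of i] by simp
    then show "(z i)\<^sup>2 = (G i)\<^sup>2 / (4 * \<beta>) / \<beta>" by (simp add: power2_eq_square)
  qed simp
  finally have 1: "(\<Sum>i\<in>I. G i * (y i - x i) + \<beta> * (y i - x i)\<^sup>2)
    \<le> (\<Sum>i\<in>I - U. (G i)\<^sup>2 / (4 * \<beta>)) + \<beta> * (\<Sum>i\<in>R. (z i)\<^sup>2) - (\<Sum>i\<in>I. (G i)\<^sup>2 / (4 * \<beta>))"
    using \<beta> by (simp add: distrib_left)
  have 2: "(\<Sum>i\<in>I. (G i)\<^sup>2 / (4 * \<beta>)) = (\<Sum>i\<in>I - U. (G i)\<^sup>2 / (4 * \<beta>)) + (\<Sum>i\<in>U. (G i)\<^sup>2 / (4 * \<beta>))"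
    by (rule sum.subset_diff[OF U fin])
  have 3: "(\<Sum>i\<in>I. \<theta> * (G i * d i) + \<beta> * \<theta>\<^sup>2 * (d i)\<^sup>2) = (\<Sum>i\<in>U. \<theta> * (G i * d i) + \<beta> * \<theta>\<^sup>2 * (d i)\<^sup>2)"
    by (rule sum.mono_neutral_right) (use fin U dU in auto)
  have 4: "(\<Sum>i\<in>U. - ((G i)\<^sup>2 / (4 * \<beta>)))
     \<le> (\<Sum>i\<in>U. 1/2 * (\<theta> * (G i * d i) + \<beta> * \<theta>\<^sup>2 * (d i)\<^sup>2) - (G i)\<^sup>2 / (8 * \<beta>))"
  proof (rule sum_mono)
    fix i
    have "0 \<le> (G i + 2 * \<beta> * \<theta> * d i)\<^sup>2 / (8 * \<beta>)" using \<beta> by simp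
    also have "\<dots> = (G i)\<^sup>2 / (8 * \<beta>) + 1/2 * (\<theta> * (G i * d i) + \<beta> * \<theta>\<^sup>2 * (d i)\<^sup>2)"
      using \<beta> by (simp add: field_simps power2_eq_square)
    finally show "- ((G i)\<^sup>2 / (4 * \<beta>)) \<le> 1/2 * (\<theta> * (G i * d i) + \<beta> * \<theta>\<^sup>2 * (d i)\<^sup>2) - (G i)\<^sup>2 / (8 * \<beta>)"
      using \<beta> by (simp add: field_simps)
  qed
  have 5: "(\<Sum>i\<in>Q. (G i)\<^sup>2 / (8 * \<beta>)) \<le> (\<Sum>i\<in>U. (G i)\<^sup>2 / (8 * \<beta>))"
    using Q finU \<beta> by (intro sum_mono2) auto
  have "\<beta> * (\<Sum>i\<in>R. (z i)\<^sup>2) \<le> \<beta> * (\<rho> * (\<Sum>i\<in>Q. (z i)\<^sup>2))"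
    using R \<beta> by simp
  also have "\<dots> = (\<Sum>i\<in>Q. \<beta> * \<rho> * (z i)\<^sup>2)" by (simp add: sum_distrib_left mult.assoc)
  \<comment> \<open>By z^2 \<le> 2 x^2 + 2 (G/(2 \<beta>))^2; \<open>\<rho> \<le> 1/4\<close> is
    what makes the gradient part fit into the G^2/(8 \<beta>) still available.\<close>
  also have "\<dots> \<le> (\<Sum>i\<in>Q. 2 * \<beta> * \<rho> * (x i)\<^sup>2 + (G i)\<^sup>2 / (8 * \<beta>))"
  proof (rule sum_mono)
    fix i assume "i \<in> Q"
    then have zi: "z i = x i - G i / (2 * \<beta>)" using Q U z by auto
    have "0 \<le> (x i + G i / (2 * \<beta>))\<^sup>2" by simp
    then have "(z i)\<^sup>2 \<le> 2 * (x i)\<^sup>2 + 2 * (G i / (2 * \<beta>))\<^sup>2"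
      unfolding zi by (simp add: power2_eq_square algebra_simps)
    then have "\<beta> * \<rho> * (z i)\<^sup>2 \<le> \<beta> * \<rho> * (2 * (x i)\<^sup>2 + 2 * (G i / (2 * \<beta>))\<^sup>2)"
      using \<beta> \<rho> by (intro mult_left_mono) auto
    also have "\<dots> = 2 * \<beta> * \<rho> * (x i)\<^sup>2 + \<rho> * ((G i)\<^sup>2 / (2 * \<beta>))"
      using \<beta> by (simp add: field_simps power2_eq_square)
    also have "\<rho> * ((G i)\<^sup>2 / (2 * \<beta>)) \<le> 1/4 * ((G i)\<^sup>2 / (2 * \<beta>))"
      using \<beta> \<rho> by (intro mult_right_mono) auto
    finally show "\<beta> * \<rho> * (z i)\<^sup>2 \<le> 2 * \<beta> * \<rho> * (x i)\<^sup>2 + (G i)\<^sup>2 / (8 * \<beta>)" by simp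
  qed
  also have "\<dots> = 2 * \<beta> * \<rho> * (\<Sum>i\<in>Q. (x i)\<^sup>2) + (\<Sum>i\<in>Q. (G i)\<^sup>2 / (8 * \<beta>))"
    by (simp add: sum.distrib sum_distrib_left)
  finally have 6: "\<beta> * (\<Sum>i\<in>R. (z i)\<^sup>2) \<le> \<dots>" .
  have "(\<Sum>i\<in>U. - ((G i)\<^sup>2 / (4 * \<beta>))) \<le> 1/2 * (\<Sum>i\<in>U. \<theta> * (G i * d i) + \<beta> * \<theta>\<^sup>2 * (d i)\<^sup>2)
      - (\<Sum>i\<in>U. (G i)\<^sup>2 / (8 * \<beta>))"
    using 4 unfolding sum_subtractf sum_distrib_left[symmetric] .
  then show ?thesis using 1 2 5 6 unfolding 3 sum_negf by linarith
qed

text \<open>Strong convexity contributes -\<Delta> + \<beta> N / 2, and the regularizer contributes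
  -\<beta> N plus an error on \<open>A\<close>. Off \<open>A\<close> the target is 0, so w x (xs -
  x) is exactly -w x^2; on \<open>A\<close> the product is split by AM-GM at the price of half of
  the strong convexity surplus. The assumption \<open>good\<close> bounds what remains.\<close>

lemma regularized_correlation_le:
  fixes x xs w G0 :: "nat \<Rightarrow> real"
  assumes fin: "finite I" and A: "A \<subseteq> I" and xs: "\<And>i. i \<in> I - A \<Longrightarrow> xs i = 0"
    and w: "\<And>i. i \<in> I \<Longrightarrow> w i = 0 \<or> 1/2 \<le> w i \<and> w i \<le> 1"
    and sc: "(\<Sum>i\<in>I. G0 i * (xs i - x i)) \<le> fs - fx - \<alpha>/2 * (\<Sum>i\<in>I. (xs i - x i)\<^sup>2)"
    and \<alpha>: "0 < \<alpha>" "\<alpha> \<le> \<beta>"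
    and N: "N = (\<Sum>i\<in>I. w i * (x i)\<^sup>2)" and M: "M = (\<Sum>i\<in>A. (w i * x i)\<^sup>2)"
    and \<kappa>: "\<kappa> = \<beta> / \<alpha>" and \<Delta>: "\<Delta> = fx + \<beta>/2 * N - fs"
    and good: "3 * \<kappa> * (\<beta> * M) \<le> \<Delta> / 2 + \<beta> * N / 4"
  shows "(\<Sum>i\<in>I. (G0 i + \<beta> * (w i * x i)) * (xs i - x i))
    \<le> - \<Delta> / 2 - \<beta> * N / 4 - \<alpha>/4 * (\<Sum>i\<in>I. (xs i - x i)\<^sup>2)"
proof -
  have \<kappa>1: "\<kappa> \<ge> 1" and \<kappa>2: "\<beta> = \<kappa> * \<alpha>" and \<beta>: "\<beta> > 0" using \<alpha> by (auto simp: \<kappa>)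
  have M0: "0 \<le> M" unfolding M by (intro sum_nonneg) auto
  have ptw: "\<beta> * (w i * x i) * (xs i - x i)
    \<le> (if i \<in> A then \<beta> * (\<kappa> + 2) * (w i * x i)\<^sup>2 else 0) + \<alpha>/4 * (xs i - x i)\<^sup>2 - \<beta> * (w i * (x i)\<^sup>2)"
    if "i \<in> I" for i
  proof (cases "i \<in> A")
    case True
    have "0 \<le> \<alpha> * (\<kappa> * (w i * x i) - (xs i - x i) / 2)\<^sup>2" using \<alpha> by simp
    also have "\<dots> = \<beta> * \<kappa> * (w i * x i)\<^sup>2 + \<alpha>/4 * (xs i - x i)\<^sup>2 - \<beta> * (w i * x i) * (xs i - x i)"
      unfolding \<kappa>2 by (simp add: power2_eq_square field_simps)
    finally have 1: "\<beta> * (w i * x i) * (xs i - x i) \<le> \<beta> * \<kappa> * (w i * x i)\<^sup>2 + \<alpha>/4 * (xs i - x i)\<^sup>2" by simp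
    \<comment> \<open>The gap between 0 and 1/2 enters here: w \<le> 2 w^2, so that -w x^2 may be
      claimed on \<open>A\<close> as well, at the price of the 2 in
      \<open>\<kappa> + 2\<close>.\<close>
    have "w i \<le> 2 * (w i * w i)" using w[OF that] by (auto intro: mult_right_mono[of "1/2" "w i" "w i"])
    then have "w i * (x i)\<^sup>2 \<le> 2 * (w i * w i) * (x i)\<^sup>2" by (intro mult_right_mono) auto
    then have "\<beta> * (w i * (x i)\<^sup>2) \<le> \<beta> * (2 * (w i * x i)\<^sup>2)"
      using \<beta> by (intro mult_left_mono) (auto simp: power2_eq_square algebra_simps)
    then show ?thesis using 1 True by (simp add: algebra_simps)
  next
    case False
    have "0 \<le> \<alpha>/4 * (xs i - x i)\<^sup>2" using \<alpha> by simp
    then show ?thesis using False xs that by (simp add: power2_eq_square)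
  qed
  have "(\<Sum>i\<in>I. \<beta> * (w i * x i) * (xs i - x i))
    \<le> (\<Sum>i\<in>I. (if i \<in> A then \<beta> * (\<kappa> + 2) * (w i * x i)\<^sup>2 else 0) + \<alpha>/4 * (xs i - x i)\<^sup>2 - \<beta> * (w i * (x i)\<^sup>2))"
    by (intro sum_mono ptw)
  also have "\<dots> = (\<Sum>i\<in>I. if i \<in> A then \<beta> * (\<kappa> + 2) * (w i * x i)\<^sup>2 else 0) + \<alpha>/4 * (\<Sum>i\<in>I. (xs i - x i)\<^sup>2) - \<beta> * N"
    by (simp add: sum.distrib sum_subtractf sum_distrib_left N)
  also have "(\<Sum>i\<in>I. if i \<in> A then \<beta> * (\<kappa> + 2) * (w i * x i)\<^sup>2 else 0) = \<beta> * (\<kappa> + 2) * M"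
    unfolding M sum_distrib_left
    by (rule sum.mono_neutral_cong_right) (use fin A in auto)
  finally have 1: "(\<Sum>i\<in>I. \<beta> * (w i * x i) * (xs i - x i))
     \<le> \<beta> * (\<kappa> + 2) * M + \<alpha>/4 * (\<Sum>i\<in>I. (xs i - x i)\<^sup>2) - \<beta> * N" .
  have "\<beta> * (\<kappa> + 2) * M \<le> 3 * \<kappa> * (\<beta> * M)"
    using \<kappa>1 M0 \<beta> mult_right_mono[of "\<kappa> + 2" "3 * \<kappa>" "\<beta> * M"] by (simp add: mult_ac)
  moreover have "(\<Sum>i\<in>I. (G0 i + \<beta> * (w i * x i)) * (xs i - x i))
    = (\<Sum>i\<in>I. G0 i * (xs i - x i)) + (\<Sum>i\<in>I. \<beta> * (w i * x i) * (xs i - x i))"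
    by (simp add: distrib_right sum.distrib)
  ultimately show ?thesis using 1 sc good unfolding \<Delta> by argo
qed

section \<open>Norms, gradients and the two quadratic bounds\<close>

lemma scalar_prod_sum: "u \<bullet> v = (\<Sum>i<dim_vec v. u $ i * v $ i)"
  by (simp add: scalar_prod_def lessThan_atLeast0)

lemma norm2_sq: "(norm2 v)\<^sup>2 = (\<Sum>i<dim_vec v. (v $ i)\<^sup>2)"
proof -
  have "0 \<le> v \<bullet> v" unfolding scalar_prod_sum by (intro sum_nonneg) auto
  then show ?thesis unfolding norm2_def by (simp add: scalar_prod_sum power2_eq_square)
qed

lemma norm2_nonneg: "0 \<le> norm2 v"
proof -
  have "0 \<le> v \<bullet> v" unfolding scalar_prod_sum by (intro sum_nonneg) auto
  then show ?thesis unfolding norm2_def by simp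
qed

lemma norm2_smult: "norm2 (a \<cdot>\<^sub>v v) = \<bar>a\<bar> * norm2 v"
proof (rule power2_eq_imp_eq)
  show "(norm2 (a \<cdot>\<^sub>v v))\<^sup>2 = (\<bar>a\<bar> * norm2 v)\<^sup>2"
    by (simp add: power_mult_distrib norm2_sq sum_distrib_left)
qed (auto simp: norm2_nonneg)

text \<open>Needed because \<open>gradient\<close> is a definite description. Along u = g - h the
  two linear models differ by r |u|^2, while both approximate \<open>f\<close> well enough to force
  this below e r |u|.\<close>

lemma has_gradient_unique:
  assumes x: "x \<in> carrier_vec n" and g: "has_gradient n f g x" and h: "has_gradient n f h x"
  shows "g = h"
proof -
  have car: "g \<in> carrier_vec n" "h \<in> carrier_vec n" using g h unfolding has_gradient_def by auto
  define u where "u = g - h"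
  have u: "u \<in> carrier_vec n" using car by (simp add: u_def)
  have "norm2 u \<le> 0 + e" if e: "e > 0" for e
  proof -
    obtain d1 where d1: "d1 > 0" "\<forall>y\<in>carrier_vec n. norm2 (y - x) < d1 \<longrightarrow>
        \<bar>f y - f x - g \<bullet> (y - x)\<bar> \<le> e / 2 * norm2 (y - x)"
      using g e unfolding has_gradient_def by (meson half_gt_zero)
    obtain d2 where d2: "d2 > 0" "\<forall>y\<in>carrier_vec n. norm2 (y - x) < d2 \<longrightarrow>
        \<bar>f y - f x - h \<bullet> (y - x)\<bar> \<le> e / 2 * norm2 (y - x)"
      using h e unfolding has_gradient_def by (meson half_gt_zero)
    \<comment> \<open>The 1 added to the denominator keeps it nonzero when \<open>u\<close>
      vanishes.\<close>
    define r where "r = min d1 d2 / 2 / (norm2 u + 1)"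
    have r: "r > 0" using d1 d2 norm2_nonneg[of u] by (simp add: r_def)
    define y where "y = x + r \<cdot>\<^sub>v u"
    have y: "y \<in> carrier_vec n" using x u by (simp add: y_def)
    have yx: "y - x = r \<cdot>\<^sub>v u" using x u by (auto simp: y_def)
    have "r * norm2 u < min d1 d2"
    proof -
      have "r * norm2 u \<le> r * (norm2 u + 1)" using r by simp
      also have "\<dots> = min d1 d2 / 2"
      proof -
        have "norm2 u + 1 \<noteq> 0" using norm2_nonneg[of u] by linarith
        then show ?thesis unfolding r_def by (rule nonzero_eq_divide_eq[THEN iffD1, OF _ refl])
      qed
      finally show ?thesis using d1 d2 by linarith
    qed
    then have lt: "norm2 (y - x) < d1" "norm2 (y - x) < d2" using r by (auto simp: yx norm2_smult)
    have "\<bar>g \<bullet> (y - x) - h \<bullet> (y - x)\<bar> \<le> e * norm2 (y - x)"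
      using d1(2)[rule_format, OF y lt(1)] d2(2)[rule_format, OF y lt(2)] by argo
    moreover have "g \<bullet> (y - x) - h \<bullet> (y - x) = r * (norm2 u)\<^sup>2"
      unfolding yx norm2_sq using car u
      by (simp add: scalar_prod_sum u_def sum_subtractf[symmetric] sum_distrib_left power2_eq_square algebra_simps)
    ultimately have "r * norm2 u * norm2 u \<le> r * norm2 u * e"
      using r norm2_nonneg[of u] by (simp add: yx norm2_smult power2_eq_square mult_ac)
    then show "norm2 u \<le> 0 + e" using r norm2_nonneg[of u] e by (cases "norm2 u = 0") auto
  qed
  then have "norm2 u \<le> 0" by (rule field_le_epsilon)
  then have "(\<Sum>i<n. (u $ i)\<^sup>2) = 0"
    using norm2_nonneg[of u] norm2_sq[of u] u by (metis carrier_vecD order_antisym zero_eq_power2)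
  then have "\<forall>i<n. u $ i = 0" by (subst (asm) sum_nonneg_eq_0_iff) auto
  then show ?thesis using car by (intro eq_vecI) (auto simp: u_def)
qed

text \<open>Used for the gradient oracle, whose answer must encode a vector of length
  \<open>n\<close>.\<close>

lemma gradient_carrier:
  assumes "vec_differentiable n f" "x \<in> carrier_vec n"
  shows "gradient n f x \<in> carrier_vec n"
proof -
  obtain g where g: "has_gradient n f g x" using assms unfolding vec_differentiable_def by blast
  then have "gradient n f x = g"
    unfolding gradient_def using has_gradient_unique assms(2) by blast
  then show ?thesis using g unfolding has_gradient_def by simp
qed

lemma smoothD:
  assumes "smooth n \<beta> f" "x \<in> carrier_vec n" "y \<in> carrier_vec n"
  shows "f y \<le> f x + (\<Sum>i<n. gradient n f x $ i * (y $ i - x $ i)) + \<beta> / 2 * (\<Sum>i<n. (y $ i - x $ i)\<^sup>2)"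
proof -
  have "f y \<le> f x + gradient n f x \<bullet> (y - x) + \<beta> / 2 * (norm2 (y - x))\<^sup>2"
    using assms unfolding smooth_def by blast
  then show ?thesis using assms by (simp add: scalar_prod_sum norm2_sq)
qed

lemma strongly_convexD:
  assumes "strongly_convex n \<alpha> f" "x \<in> carrier_vec n" "y \<in> carrier_vec n"
  shows "f y \<ge> f x + (\<Sum>i<n. gradient n f x $ i * (y $ i - x $ i)) + \<alpha> / 2 * (\<Sum>i<n. (y $ i - x $ i)\<^sup>2)"
proof -
  have "f y \<ge> f x + gradient n f x \<bullet> (y - x) + \<alpha> / 2 * (norm2 (y - x))\<^sup>2"
    using assms unfolding strongly_convex_def by blast
  then show ?thesis using assms by (simp add: scalar_prod_sum norm2_sq)
qed

text \<open>Both quadratic bounds apply to the same pair of distinct points, which exists because n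
  \<ge> 1. The consequence \<kappa> \<ge> 1 is used throughout the estimates.\<close>

lemma strong_convexity_le_smoothness:
  assumes "smooth n \<beta> f" "strongly_convex n \<alpha> f" "n \<ge> 1"
  shows "\<alpha> \<le> \<beta>"
proof -
  let ?x = "0\<^sub>v n :: real vec" and ?y = "vec n (\<lambda>_. 1) :: real vec"
  have "\<alpha> / 2 * (\<Sum>i<n. (?y $ i - ?x $ i)\<^sup>2) \<le> \<beta> / 2 * (\<Sum>i<n. (?y $ i - ?x $ i)\<^sup>2)"
    using smoothD[OF assms(1), of ?x ?y] strongly_convexD[OF assms(2), of ?x ?y] by simp
  then show ?thesis using assms(3) by simp
qed

section \<open>Contraction when the regularizer is not in the way\<close>

text \<open>The assumption \<open>good\<close> makes the correlation estimate available. The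
  constants are tuned so that the terms in |xs - x|^2 and in the weighted norm cancel exactly,
  leaving a decrease of \<theta> \<Delta> / 4.\<close>

lemma iht_step_good:
  fixes f :: "real vec \<Rightarrow> real" and x xs w y :: "real vec"
  assumes sm: "smooth n \<beta> f" and sc: "strongly_convex n \<alpha> f"
    and car: "x \<in> carrier_vec n" "xs \<in> carrier_vec n"
    and \<alpha>: "0 < \<alpha>" "\<alpha> \<le> \<beta>"
    and ht: "hard_threshold s' (vec n (\<lambda>i. (1 - 0.5 * w $ i) * x $ i - 1 / (2 * \<beta>) * gradient n f x $ i)) y"
    and w: "\<And>i. i < n \<Longrightarrow> w $ i = 0 \<or> 1/2 \<le> w $ i \<and> w $ i \<le> 1"
    and zeros: "2 * card {i. i < n \<and> w $ i = 0} \<le> s'"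
    and sp: "sparse s' x" "sparse s xs" "1 \<le> s"
    and \<kappa>: "\<kappa> = \<beta> / \<alpha>" and s': "258 * real s * \<kappa> \<le> real s'"
    and \<Delta>: "\<Delta> = f x + \<beta>/2 * wnorm_sq w x - f xs"
    and good: "3 * \<kappa> * (\<beta> * (\<Sum>i | i < n \<and> xs $ i \<noteq> 0. (w $ i * x $ i)\<^sup>2)) \<le> \<Delta> / 2 + \<beta> * wnorm_sq w x / 4"
  shows "f y + \<beta>/2 * wnorm_sq w y - f xs \<le> (1 - 1 / (16 * \<kappa>)) * \<Delta>"
proof -
  define I where "I = {..<n}"
  define X where "X = {i. i < n \<and> x $ i \<noteq> 0}"
  define A where "A = {i. i < n \<and> xs $ i \<noteq> 0}"
  define U where "U = X \<union> A"
  define Z where "Z = {i. i < n \<and> w $ i = 0}"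
  define Q where "Q = X - A - Z"
  \<comment> \<open>The number of coordinates by which the joint support exceeds the budget;
    truncated subtraction gives 0 if it fits.\<close>
  define r where "r = card U - s'"
  define G where "G = (\<lambda>i. gradient n f x $ i + \<beta> * (w $ i * x $ i))"
  define z where "z = (\<lambda>i. x $ i - G i / (2 * \<beta>))"
  define d where "d = (\<lambda>i. xs $ i - x $ i)"
  define \<rho> where "\<rho> = 1 / (128 * \<kappa>)"
  define \<theta> where "\<theta> = 1 / (4 * \<kappa>)"
  define N where "N = wnorm_sq w x"
  have \<beta>: "\<beta> > 0" and \<kappa>1: "\<kappa> \<ge> 1" using \<alpha> by (auto simp: \<kappa>)
  have dims: "dim_vec x = n" "dim_vec xs = n" using car by auto
  have fin: "finite I" "finite X" "finite A" "finite U" "finite Q" "finite Z"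
    by (auto simp: I_def X_def A_def U_def Q_def Z_def)
  have sub: "X \<subseteq> I" "A \<subseteq> I" "U \<subseteq> I" "Q \<subseteq> U" by (auto simp: I_def X_def A_def U_def Q_def)
  have cards: "card X \<le> s'" "card A \<le> s" "2 * card Z \<le> s'"
    using sp zeros by (auto simp: sparse_def X_def A_def Z_def dims)
  obtain S where S: "S \<subseteq> I" "card S = min s' n" "\<And>i j. i \<in> S \<Longrightarrow> j \<in> I - S \<Longrightarrow> \<bar>z j\<bar> \<le> \<bar>z i\<bar>"
    and yS: "y = vec n (\<lambda>i. if i \<in> S then z i else 0)"
  proof -
    \<comment> \<open>The regularizer \<open>\<beta>/2 * wnorm_sq w x\<close> has gradient \<beta> w
      x, and 1/(2 \<beta>) times this is the w x / 2 that the algorithm subtracts.\<close>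
    have zv: "vec n (\<lambda>i. (1 - 0.5 * w $ i) * x $ i - 1 / (2 * \<beta>) * gradient n f x $ i) = vec n z"
      using \<beta> by (intro eq_vecI) (auto simp: z_def G_def field_simps)
    obtain S where 1: "S \<subseteq> {..<n}" "card S = min s' n"
      "\<forall>i\<in>S. \<forall>j\<in>{..<n} - S. \<bar>vec n z $ j\<bar> \<le> \<bar>vec n z $ i\<bar>"
      "y = vec n (\<lambda>i. if i \<in> S then vec n z $ i else 0)"
      using ht unfolding zv hard_threshold_def by auto
    have "\<bar>z j\<bar> \<le> \<bar>z i\<bar>" if "i \<in> S" "j \<in> I - S" for i j
      using 1(1,3) that by (force simp: I_def)
    moreover have "y = vec n (\<lambda>i. if i \<in> S then z i else 0)"
      unfolding 1(4) by (intro eq_vecI) auto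
    ultimately show thesis using that 1(1,2) by (auto simp: I_def)
  qed
  have y: "y \<in> carrier_vec n" "\<And>i. i \<in> I \<Longrightarrow> y $ i = (if i \<in> S then z i else 0)"
    by (auto simp: yS I_def)
  have cU: "card U \<le> card X + card A" unfolding U_def by (rule card_Un_le)
  have s\<kappa>: "real s \<le> real s * \<kappa>" using \<kappa>1 by (simp add: mult_le_cancel_left1)
  have r_le: "r \<le> s" unfolding r_def using cU cards by linarith
  \<comment> \<open>From s' < |Q| + |Z| + |A| with |Z| \<le> s'/2 and |A| \<le> s follows |Q| \<ge>
    s'/2 - s. This is the origin of 258 = 2 * 128 + 2.\<close>
  have cQ: "128 * real s * \<kappa> \<le> real (card Q)" if "r > 0"
  proof -
    have "card U = card (X - A) + card A"
      unfolding U_def using fin by (metis card_Un_disjnt Un_Diff_cancel2 disjnt_def Diff_disjoint finite_Diff inf_commute)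
    moreover have "card (X - A) \<le> card Q + card Z"
      unfolding Q_def using fin diff_card_le_card_Diff[of Z "X - A"] by linarith
    moreover have "card U > s'" using that unfolding r_def by simp
    ultimately have "s' < card Q + card Z + card A" by linarith
    then have "2 * s' < 2 * card Q + s' + 2 * s" using cards by linarith
    then have "real s' \<le> 2 * real (card Q) + 2 * real s" by linarith
    then show ?thesis using s' s\<kappa> by linarith
  qed
  have rQ: "r \<le> card Q"
  proof (cases "r > 0")
    case True
    then have "real r \<le> real (card Q)" using cQ r_le s\<kappa> of_nat_mono[OF r_le, where ?'a = real]  by linarith
    then show ?thesis by simp
  qed simp
  obtain R where R: "R \<subseteq> Q" "card R = r" "\<forall>a\<in>R. \<forall>b\<in>Q - R. (z a)\<^sup>2 \<le> (z b)\<^sup>2"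
    using ex_smallest_subset[OF fin(5) rQ, of "\<lambda>i. (z i)\<^sup>2"] by blast
  have \<rho>: "0 \<le> \<rho>" "\<rho> \<le> 1/4" using \<kappa>1 by (auto simp: \<rho>_def field_simps)
  have Rsum: "(\<Sum>i\<in>R. (z i)\<^sup>2) \<le> \<rho> * (\<Sum>i\<in>Q. (z i)\<^sup>2)"
  proof (cases "r = 0")
    case True
    then have "R = {}" using R fin finite_subset by (metis card_0_eq)
    then show ?thesis using \<rho> by (simp add: sum_nonneg)
  next
    case False
    then have c: "128 * real s * \<kappa> \<le> real (card Q)" using cQ by simp
    have nn: "0 \<le> (\<Sum>i\<in>R. (z i)\<^sup>2)" "0 \<le> (\<Sum>i\<in>Q. (z i)\<^sup>2)" by (auto intro: sum_nonneg)
    have "(128 * real s * \<kappa>) * (\<Sum>i\<in>R. (z i)\<^sup>2) \<le> real (card Q) * (\<Sum>i\<in>R. (z i)\<^sup>2)"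
      using c nn by (intro mult_right_mono) auto
    also have "\<dots> \<le> real (card R) * (\<Sum>i\<in>Q. (z i)\<^sup>2)"
      using R by (intro sum_smallest_le fin) auto
    also have "\<dots> \<le> real s * (\<Sum>i\<in>Q. (z i)\<^sup>2)"
      using R r_le nn by (intro mult_right_mono) auto
    finally have "real s * (128 * \<kappa> * (\<Sum>i\<in>R. (z i)\<^sup>2)) \<le> real s * (\<Sum>i\<in>Q. (z i)\<^sup>2)" by (simp add: mult_ac)
    then have "128 * \<kappa> * (\<Sum>i\<in>R. (z i)\<^sup>2) \<le> (\<Sum>i\<in>Q. (z i)\<^sup>2)" using sp(3) by simp
    then show ?thesis using \<kappa>1 by (simp add: \<rho>_def field_simps)
  qed
  have cUR: "card (U - R) \<le> card S"
  proof -
    have "card (U - R) = card U - r" using R sub fin by (metis card_Diff_subset finite_subset subset_trans)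
    moreover have "card U \<le> n" using sub card_mono[of I U] by (simp add: I_def)
    ultimately show ?thesis unfolding S(2) r_def by linarith
  qed
  have xU: "x $ i = 0" "d i = 0" if "i \<in> I - U" for i
    using that by (auto simp: U_def X_def A_def I_def d_def)
  have D: "(\<Sum>i\<in>I. G i * (y $ i - x $ i) + \<beta> * (y $ i - x $ i)\<^sup>2)
    \<le> 1/2 * (\<Sum>i\<in>I. \<theta> * (G i * d i) + \<beta> * \<theta>\<^sup>2 * (d i)\<^sup>2) + 2 * \<beta> * \<rho> * (\<Sum>i\<in>Q. (x $ i)\<^sup>2)"
    by (rule threshold_descent[where z = z, OF fin(1) S(1) S(3) sub(3) xU R(1) sub(4) cUR _ y(2) Rsum \<rho> \<beta>])
      (auto simp: z_def)
  have N: "N = (\<Sum>i\<in>I. w $ i * (x $ i)\<^sup>2)" by (simp add: N_def wnorm_sq_def dims I_def)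
  have w': "w $ i = 0 \<or> 1/2 \<le> w $ i \<and> w $ i \<le> 1" if "i \<in> I" for i using w that by (simp add: I_def)
  have w0: "0 \<le> w $ i" if "i \<in> I" for i using w'[OF that] by auto
  have xQ: "(\<Sum>i\<in>Q. (x $ i)\<^sup>2) \<le> 2 * N"
  proof -
    have "(\<Sum>i\<in>Q. (x $ i)\<^sup>2) \<le> (\<Sum>i\<in>Q. 2 * (w $ i * (x $ i)\<^sup>2))"
    proof (rule sum_mono)
      fix i assume "i \<in> Q"
      then have "1/2 \<le> w $ i" using w[of i] by (auto simp: Q_def X_def Z_def)
      then have "1/2 * (x $ i)\<^sup>2 \<le> w $ i * (x $ i)\<^sup>2" by (intro mult_right_mono) auto
      then show "(x $ i)\<^sup>2 \<le> 2 * (w $ i * (x $ i)\<^sup>2)" by simp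
    qed
    also have "\<dots> \<le> (\<Sum>i\<in>I. 2 * (w $ i * (x $ i)\<^sup>2))"
      using fin sub w0 by (intro sum_mono2) auto
    finally show ?thesis by (simp add: N sum_distrib_left)
  qed
  have C: "(\<Sum>i\<in>I. G i * d i) \<le> - \<Delta> / 2 - \<beta> * N / 4 - \<alpha>/4 * (\<Sum>i\<in>I. (d i)\<^sup>2)"
    unfolding G_def d_def
  proof (rule regularized_correlation_le[OF fin(1) sub(2) _ w' _ \<alpha> N refl \<kappa>])
    show "\<Delta> = f x + \<beta> / 2 * N - f xs" unfolding \<Delta> N_def ..
    show "(\<Sum>i\<in>I. gradient n f x $ i * (xs $ i - x $ i)) \<le> f xs - f x - \<alpha> / 2 * (\<Sum>i\<in>I. (xs $ i - x $ i)\<^sup>2)"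
      using strongly_convexD[OF sc car] by (simp add: I_def)
    show "3 * \<kappa> * (\<beta> * (\<Sum>i\<in>A. (w $ i * x $ i)\<^sup>2)) \<le> \<Delta> / 2 + \<beta> * N / 4"
      using good by (simp add: A_def N_def)
  qed (auto simp: A_def I_def)
  have E: "f y + \<beta>/2 * wnorm_sq w y \<le> f x + \<beta>/2 * N + (\<Sum>i\<in>I. G i * (y $ i - x $ i) + \<beta> * (y $ i - x $ i)\<^sup>2)"
  proof -
    \<comment> \<open>The regularized objective is 2 \<beta>-smooth because w \<le> 1; in each
      coordinate the slack is \<beta>/2 (1 - w) (y - x)^2.\<close>
    have *: "(\<Sum>i\<in>I. gradient n f x $ i * (y $ i - x $ i) + \<beta>/2 * (y $ i - x $ i)\<^sup>2 + \<beta>/2 * (w $ i * (y $ i)\<^sup>2))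
      \<le> (\<Sum>i\<in>I. \<beta>/2 * (w $ i * (x $ i)\<^sup>2) + (G i * (y $ i - x $ i) + \<beta> * (y $ i - x $ i)\<^sup>2))"
    proof (rule sum_mono)
      fix i assume i: "i \<in> I"
      have "0 \<le> \<beta>/2 * ((1 - w $ i) * (y $ i - x $ i)\<^sup>2)" using \<beta> w'[OF i] by auto
      then show "gradient n f x $ i * (y $ i - x $ i) + \<beta>/2 * (y $ i - x $ i)\<^sup>2 + \<beta>/2 * (w $ i * (y $ i)\<^sup>2)
       \<le> \<beta>/2 * (w $ i * (x $ i)\<^sup>2) + (G i * (y $ i - x $ i) + \<beta> * (y $ i - x $ i)\<^sup>2)"
        by (simp add: G_def power2_eq_square field_simps)
    qed
    have wy: "wnorm_sq w y = (\<Sum>i\<in>I. w $ i * (y $ i)\<^sup>2)" using y(1) by (simp add: wnorm_sq_def I_def)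
    show ?thesis
      using smoothD[OF sm car(1) y(1)] *[unfolded sum.distrib sum_distrib_left[symmetric]]
      unfolding N wy sum.distrib sum_distrib_left[symmetric] I_def by linarith
  qed
  have N0: "0 \<le> N" unfolding N using w0 by (intro sum_nonneg) auto
  have dd: "0 \<le> (\<Sum>i\<in>I. (d i)\<^sup>2)" by (intro sum_nonneg) auto
  \<comment> \<open>\<theta> = 1/(4 \<kappa>) is chosen so that the quadratic cost of the comparison
    step equals the surplus \<alpha>/4 left over in the correlation.\<close>
  have \<beta>\<theta>: "\<beta> * \<theta>\<^sup>2 = \<theta> * (\<alpha> / 4)" using \<alpha> by (simp add: \<theta>_def \<kappa> power2_eq_square)
  have "(\<Sum>i\<in>I. \<theta> * (G i * d i) + \<beta> * \<theta>\<^sup>2 * (d i)\<^sup>2) = \<theta> * ((\<Sum>i\<in>I. G i * d i) + \<alpha>/4 * (\<Sum>i\<in>I. (d i)\<^sup>2))"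
    unfolding \<beta>\<theta> by (simp add: sum.distrib sum_distrib_left distrib_left mult.assoc)
  also have "\<dots> \<le> \<theta> * (- \<Delta> / 2 - \<beta> * N / 4)"
    using C \<kappa>1 by (intro mult_left_mono) (auto simp: \<theta>_def)
  finally have F: "(\<Sum>i\<in>I. \<theta> * (G i * d i) + \<beta> * \<theta>\<^sup>2 * (d i)\<^sup>2) \<le> \<theta> * (- \<Delta> / 2 - \<beta> * N / 4)" .
  \<comment> \<open>With \<rho> = 1/(128 \<kappa>) the sacrifice costs at most what the term
    -\<beta> N / 4 of the correlation gains after halving.\<close>
  have "2 * \<beta> * \<rho> * (\<Sum>i\<in>Q. (x $ i)\<^sup>2) \<le> 2 * \<beta> * \<rho> * (2 * N)"
    using xQ \<beta> \<rho> by (intro mult_left_mono) auto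
  also have "\<dots> = \<theta> * (\<beta> * N / 8)" by (simp add: \<theta>_def \<rho>_def)
  finally have H: "2 * \<beta> * \<rho> * (\<Sum>i\<in>Q. (x $ i)\<^sup>2) \<le> \<theta> * (\<beta> * N / 8)" .
  have "f y + \<beta>/2 * wnorm_sq w y - f xs \<le> \<Delta> + (1/2 * (\<theta> * (- \<Delta> / 2 - \<beta> * N / 4)) + \<theta> * (\<beta> * N / 8))"
    using D E F H unfolding \<Delta> N_def by linarith
  also have "\<dots> = (1 - 1 / (16 * \<kappa>)) * \<Delta>"
  proof -
    have *: "1 / (16 * \<kappa>) = \<theta> / 4" by (simp add: \<theta>_def)
    show ?thesis unfolding * by (simp add: algebra_simps)
  qed
  finally show ?thesis .
qed

section \<open>Admissible weights and the total weight lost\<close>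

definition admissible_weights :: "nat \<Rightarrow> real vec \<Rightarrow> bool" where
  "admissible_weights n w \<longleftrightarrow> w \<in> carrier_vec n \<and> (\<forall>i<n. w $ i = 0 \<or> 1/2 \<le> w $ i \<and> w $ i \<le> 1)"

lemma admissible_weights_bounds:
  assumes "admissible_weights n w" "i < n"
  shows "0 \<le> w $ i" "w $ i \<le> 1"
  using assms unfolding admissible_weights_def by force+

text \<open>If the weighted norm is zero, the subtracted term below vanishes because \<open>a / 0 = 0\<close>.\<close>
lemma update_weights_nth:
  assumes "admissible_weights n w" "i < n"
  shows "update_weights c x w $ i =
    (let v = w $ i - c * (w $ i * x $ i)\<^sup>2 / wnorm_sq w x in if v < 1/2 then 0 else v)"
  using assms unfolding admissible_weights_def update_weights_def threshold_half_def Let_def by force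

lemma update_weights_carrier:
  assumes "w \<in> carrier_vec n"
  shows "update_weights c x w \<in> carrier_vec n"
  using assms unfolding update_weights_def threshold_half_def by auto

lemma wnorm_sq_nonneg:
  assumes "admissible_weights n w" "x \<in> carrier_vec n"
  shows "0 \<le> wnorm_sq w x"
  using assms admissible_weights_bounds(1) unfolding wnorm_sq_def by (intro sum_nonneg) auto

lemma update_weights_admissible:
  assumes w: "admissible_weights n w" and x: "x \<in> carrier_vec n" and c: "0 \<le> c"
  shows "admissible_weights n (update_weights c x w)"
    and "i < n \<Longrightarrow> update_weights c x w $ i \<le> w $ i"
proof -
  have d: "0 \<le> c * (w $ i * x $ i)\<^sup>2 / wnorm_sq w x" for i
    using c wnorm_sq_nonneg[OF w x] by auto
  have le: "update_weights c x w $ i \<le> w $ i" if "i < n" for i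
    using admissible_weights_bounds[OF w that] d[of i] by (auto simp: update_weights_nth[OF w that] Let_def)
  then show "i < n \<Longrightarrow> update_weights c x w $ i \<le> w $ i" .
  show "admissible_weights n (update_weights c x w)"
    unfolding admissible_weights_def
  proof (intro conjI allI impI)
    show "update_weights c x w \<in> carrier_vec n"
      using w update_weights_carrier unfolding admissible_weights_def by blast
    fix i assume i: "i < n"
    have "update_weights c x w $ i \<le> 1" using le[OF i] admissible_weights_bounds[OF w i] by linarith
    moreover have "update_weights c x w $ i = 0 \<or> 1/2 \<le> update_weights c x w $ i"
      by (auto simp: update_weights_nth[OF w i] Let_def)
    ultimately show "update_weights c x w $ i = 0 \<or> 1/2 \<le> update_weights c x w $ i \<and> update_weights c x w $ i \<le> 1" by auto
  qed
qed

text \<open>A weight that is cut to zero is only known to have lost \<open>1/2\<close> through the updates.\<close>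
definition lost_weight :: "nat \<Rightarrow> real vec \<Rightarrow> real" where
  "lost_weight n w = (\<Sum>i<n. if w $ i = 0 then 1/2 else 1 - w $ i)"

text \<open>The subtracted amounts add up to \<open>c\<close> times the sum of (w x)^2 over the
  weighted norm, and w^2 \<le> w bounds this quotient by 1. A coordinate that is cut has accumulated
  more than 1/2 but is charged only 1/2.\<close>

lemma lost_weight_update_le:
  assumes w: "admissible_weights n w" and x: "x \<in> carrier_vec n" and c: "0 \<le> c"
  shows "lost_weight n (update_weights c x w) \<le> lost_weight n w + c"
proof -
  define N where "N = wnorm_sq w x"
  have N0: "0 \<le> N" unfolding N_def by (rule wnorm_sq_nonneg[OF w x])
  have NS: "N = (\<Sum>i<n. w $ i * (x $ i)\<^sup>2)" using x by (simp add: N_def wnorm_sq_def)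
  have "lost_weight n (update_weights c x w) \<le>
    (\<Sum>i<n. (if w $ i = 0 then 1/2 else 1 - w $ i) + c * (w $ i * x $ i)\<^sup>2 / N)"
    unfolding lost_weight_def
  proof (rule sum_mono)
    fix i assume "i \<in> {..<n}"
    then have i: "i < n" by simp
    have "0 \<le> c * (w $ i * x $ i)\<^sup>2 / N" using c N0 by auto
    moreover have "w $ i = 0 \<or> 1/2 \<le> w $ i" using w i unfolding admissible_weights_def by auto
    ultimately show "(if update_weights c x w $ i = 0 then 1/2 else 1 - update_weights c x w $ i)
      \<le> (if w $ i = 0 then 1/2 else 1 - w $ i) + c * (w $ i * x $ i)\<^sup>2 / N"
      by (auto simp: update_weights_nth[OF w i] Let_def N_def)
  qed
  also have "\<dots> = lost_weight n w + c * (\<Sum>i<n. (w $ i * x $ i)\<^sup>2) / N"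
    unfolding lost_weight_def by (simp add: sum.distrib sum_distrib_left sum_divide_distrib)
  also have "c * (\<Sum>i<n. (w $ i * x $ i)\<^sup>2) / N \<le> c"
  proof -
    have "(\<Sum>i<n. (w $ i * x $ i)\<^sup>2) \<le> N" unfolding NS
    proof (rule sum_mono)
      fix i assume "i \<in> {..<n}"
      then have "w $ i * w $ i \<le> w $ i * 1"
        using admissible_weights_bounds[OF w, of i] by (intro mult_left_mono) auto
      then have "(w $ i * w $ i) * (x $ i)\<^sup>2 \<le> (w $ i) * (x $ i)\<^sup>2" by (intro mult_right_mono) auto
      then show "(w $ i * x $ i)\<^sup>2 \<le> w $ i * (x $ i)\<^sup>2" by (simp add: power2_eq_square mult_ac)
    qed
    then have "c * (\<Sum>i<n. (w $ i * x $ i)\<^sup>2) \<le> c * N" using c by (intro mult_left_mono) auto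
    then show ?thesis using N0 c by (cases "N = 0") (auto simp: divide_le_eq)
  qed
  finally show ?thesis by simp
qed

text \<open>With a loss of at most \<open>c\<close> per iteration and c T = s'/4, this bounds the
  number of coordinates of weight zero by s'/2.\<close>

lemma card_zeros_le_lost_weight:
  assumes "admissible_weights n w"
  shows "real (card {i. i < n \<and> w $ i = 0}) \<le> 2 * lost_weight n w"
proof -
  have "real (card {i. i < n \<and> w $ i = 0}) = (\<Sum>i | i < n \<and> w $ i = 0. 1)" by simp
  also have "\<dots> = (\<Sum>i<n. if w $ i = 0 then 1 else 0)"
    by (rule sum.mono_neutral_cong_left) auto
  also have "\<dots> \<le> (\<Sum>i<n. 2 * (if w $ i = 0 then 1/2 else 1 - w $ i))"
    using admissible_weights_bounds[OF assms] by (intro sum_mono) auto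
  finally show ?thesis by (simp add: lost_weight_def sum_distrib_left)
qed

section \<open>Existence of thresholded vectors and of runs\<close>

lemma hard_threshold_carrier_sparse:
  assumes "hard_threshold k (vec n z) y"
  shows "y \<in> carrier_vec n" "sparse k y"
proof -
  obtain S where S: "S \<subseteq> {..<n}" "card S = min k n" "y = vec n (\<lambda>i. if i \<in> S then vec n z $ i else 0)"
    using assms unfolding hard_threshold_def by auto
  show "y \<in> carrier_vec n" by (simp add: S)
  have "{i. i < dim_vec y \<and> y $ i \<noteq> 0} \<subseteq> S" by (auto simp: S split: if_splits)
  then have "card {i. i < dim_vec y \<and> y $ i \<noteq> 0} \<le> card S"
    using S(1) finite_subset by (intro card_mono) auto
  then show "sparse k y" unfolding sparse_def S(2) by simp
qed

lemma hard_threshold_ex: "\<exists>y. hard_threshold k z y"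
proof -
  obtain S where S: "S \<subseteq> {..<dim_vec z}" "card S = min k (dim_vec z)"
    "\<forall>a\<in>S. \<forall>b\<in>{..<dim_vec z} - S. - \<bar>z $ a\<bar> \<le> - \<bar>z $ b\<bar>"
    using ex_smallest_subset[of "{..<dim_vec z}" "min k (dim_vec z)" "\<lambda>i. - \<bar>z $ i\<bar>"] by auto
  then show ?thesis unfolding hard_threshold_def by (intro exI[of _ "vec (dim_vec z) (\<lambda>i. if i \<in> S then z $ i else 0)"] exI[of _ S]) auto
qed

text \<open>Ties make the step a relation, so a run arises by choosing a successor for every state;
  thresholding is possible in all of them. This keeps the guarantee for all runs from being
  vacuous.\<close>

lemma riht_run_ex: "\<exists>X W. riht_run n f s' \<eta> c T x0 X W"
proof -
  have "\<exists>q. riht_step n f s' \<eta> c (fst p) (snd p) (fst q) (snd q)" for p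
  proof -
    obtain y where y: "hard_threshold s' (vec n (\<lambda>i. (1 - 0.5 * snd p $ i) * fst p $ i - \<eta> * gradient n f (fst p) $ i)) y"
      using hard_threshold_ex by blast
    let ?w' = "update_weights c (fst p) (snd p)"
    let ?x' = "if f y + 1 / (4 * \<eta>) * wnorm_sq ?w' y > f (fst p) + 1 / (4 * \<eta>) * wnorm_sq ?w' (fst p) then fst p else y"
    show ?thesis
      unfolding riht_step_def by (rule exI[of _ "(?x', ?w')"], rule exI[of _ y]) (use y in simp)
  qed
  then have "\<forall>p. \<exists>q. riht_step n f s' \<eta> c (fst p) (snd p) (fst q) (snd q)" by blast
  from choice[OF this] obtain F where F: "\<And>p. riht_step n f s' \<eta> c (fst p) (snd p) (fst (F p)) (snd (F p))"
    by blast
  define h where "h t = (F ^^ t) (x0, vec n (\<lambda>_. 1))" for t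
  have "riht_run n f s' \<eta> c T x0 (\<lambda>t. fst (h t)) (\<lambda>t. snd (h t))"
    unfolding riht_run_def using F by (simp add: h_def)
  then show ?thesis by blast
qed

section \<open>Progress of one iteration and convergence\<close>

lemma wnorm_sq_mono:
  assumes "x \<in> carrier_vec n" "\<And>i. i < n \<Longrightarrow> v $ i \<le> w $ i"
  shows "wnorm_sq v x \<le> wnorm_sq w x"
  unfolding wnorm_sq_def using assms by (intro sum_mono mult_right_mono) auto

text \<open>An iteration makes progress either in the regularized objective or by lowering the total
  weight of the support of the target.  The latter can fail to drop by the full amount when
  weights are cut to zero, but then the regularization term itself drops.\<close>
lemma riht_step_progress:
  fixes f :: "real vec \<Rightarrow> real" and x xs w x' w' :: "real vec"
  assumes sm: "smooth n \<beta> f" and sc: "strongly_convex n \<alpha> f"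
    and car: "x \<in> carrier_vec n" "xs \<in> carrier_vec n"
    and \<alpha>: "0 < \<alpha>" "\<alpha> \<le> \<beta>" and c: "0 \<le> c"
    and step: "riht_step n f s' (1 / (2 * \<beta>)) c x w x' w'"
    and w: "admissible_weights n w"
    and lost: "lost_weight n w \<le> real s' / 4"
    and sp: "sparse s' x" "sparse s xs" "1 \<le> s"
    and \<kappa>: "\<kappa> = \<beta> / \<alpha>" and s': "258 * real s * \<kappa> \<le> real s'"
    and \<Delta>: "\<Delta> = f x + \<beta>/2 * wnorm_sq w x - f xs" and \<Delta>': "\<Delta>' = f x' + \<beta>/2 * wnorm_sq w' x' - f xs"
    and A: "A = {i. i < n \<and> xs $ i \<noteq> 0}"
  shows "x' \<in> carrier_vec n" "sparse s' x'" "admissible_weights n w'" "lost_weight n w' \<le> lost_weight n w + c"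
    "\<Delta>' \<le> \<Delta>" "(\<Sum>i\<in>A. w' $ i) \<le> (\<Sum>i\<in>A. w $ i)"
    "0 \<le> \<Delta> \<Longrightarrow> \<Delta>' \<le> (1 - 1 / (24 * \<kappa>)) * \<Delta> \<or> (\<Sum>i\<in>A. w' $ i) \<le> (\<Sum>i\<in>A. w $ i) - c / (24 * \<kappa>)"
proof -
  have \<beta>: "\<beta> > 0" and \<kappa>1: "\<kappa> \<ge> 1" using \<alpha> by (auto simp: \<kappa>)
  obtain y where y: "hard_threshold s' (vec n (\<lambda>i. (1 - 0.5 * w $ i) * x $ i - 1 / (2 * \<beta>) * gradient n f x $ i)) y"
    and w': "w' = update_weights c x w"
    and x': "x' = (if f y + 1 / (4 * (1 / (2 * \<beta>))) * wnorm_sq w' y > f x + 1 / (4 * (1 / (2 * \<beta>))) * wnorm_sq w' x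
           then x else y)"
    using step unfolding riht_step_def by auto
  have yc: "y \<in> carrier_vec n" "sparse s' y" using hard_threshold_carrier_sparse[OF y] .
  have reg: "1 / (4 * (1 / (2 * \<beta>))) = \<beta> / 2" by simp
  show "x' \<in> carrier_vec n" "sparse s' x'" using yc car sp by (auto simp: x')
  show w'_adm: "admissible_weights n w'" unfolding w' by (rule update_weights_admissible(1)[OF w car(1) c])
  show "lost_weight n w' \<le> lost_weight n w + c" unfolding w' by (rule lost_weight_update_le[OF w car(1) c])
  have w'_le: "w' $ i \<le> w $ i" if "i < n" for i
    unfolding w' by (rule update_weights_admissible(2)[OF w car(1) c that])
  \<comment> \<open>The acceptance test compares both candidates under the new weights, so the
    outcome is bounded by each of them; since the weights only decrease, both bounds carry over to
    the old weights.\<close>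
  have min: "\<Delta>' \<le> f x + \<beta>/2 * wnorm_sq w' x - f xs" "\<Delta>' \<le> f y + \<beta>/2 * wnorm_sq w' y - f xs"
    unfolding \<Delta>' x' reg by auto
  have mono: "\<beta>/2 * wnorm_sq w' x \<le> \<beta>/2 * wnorm_sq w x" "\<beta>/2 * wnorm_sq w' y \<le> \<beta>/2 * wnorm_sq w y"
    using \<beta> by (auto intro!: wnorm_sq_mono w'_le car yc)
  show "\<Delta>' \<le> \<Delta>" using min(1) mono(1) unfolding \<Delta> by linarith
  show "(\<Sum>i\<in>A. w' $ i) \<le> (\<Sum>i\<in>A. w $ i)" using w'_le by (intro sum_mono) (auto simp: A)
  assume \<Delta>0: "0 \<le> \<Delta>"
  define N where "N = wnorm_sq w x"
  define M where "M = (\<Sum>i\<in>A. (w $ i * x $ i)\<^sup>2)"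
  have N0: "0 \<le> N" unfolding N_def by (rule wnorm_sq_nonneg[OF w car(1)])
  have finA: "finite A" by (simp add: A)
  show "\<Delta>' \<le> (1 - 1 / (24 * \<kappa>)) * \<Delta> \<or> (\<Sum>i\<in>A. w' $ i) \<le> (\<Sum>i\<in>A. w $ i) - c / (24 * \<kappa>)"
  proof (cases "3 * \<kappa> * (\<beta> * M) \<le> \<Delta> / 2 + \<beta> * N / 4")
    case True
    have "real (2 * card {i. i < n \<and> w $ i = 0}) \<le> real s'"
      using card_zeros_le_lost_weight[OF w] lost by simp
    then have z: "2 * card {i. i < n \<and> w $ i = 0} \<le> s'" by linarith
    have "f y + \<beta>/2 * wnorm_sq w y - f xs \<le> (1 - 1 / (16 * \<kappa>)) * \<Delta>"
      using True w unfolding M_def N_def A admissible_weights_def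
      by (intro iht_step_good[OF sm sc car \<alpha> y _ z sp \<kappa> s' \<Delta>]) auto
    moreover have "(1 - 1 / (16 * \<kappa>)) * \<Delta> \<le> (1 - 1 / (24 * \<kappa>)) * \<Delta>"
      using \<Delta>0 \<kappa>1 by (intro mult_right_mono) (auto simp: field_simps)
    ultimately show ?thesis using min(2) mono(2) by linarith
  next
    case False
    have \<beta>N: "0 \<le> \<beta> * N" using \<beta> N0 by simp
    \<comment> \<open>The failed inequality is read twice, once without the \<Delta> term and once
      without the term in \<open>N\<close>; both terms are nonnegative.\<close>
    have b1: "\<beta> * N \<le> \<beta> * (12 * \<kappa> * M)" and b2: "\<Delta> / (6 * \<kappa>) \<le> \<beta> * M"
      using False \<Delta>0 \<beta>N \<kappa>1 by (auto simp: field_simps)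
    have NM: "N \<le> 12 * \<kappa> * M" using b1 \<beta> by simp
    have Mpos: "0 < M"
    proof (rule ccontr)
      assume "\<not> 0 < M"
      then have "3 * \<kappa> * (\<beta> * M) \<le> 0" using \<beta> \<kappa>1 by (simp add: mult_le_0_iff)
      then show False using False \<Delta>0 \<beta>N by linarith
    qed
    define \<delta> where "\<delta> i = c * (w $ i * x $ i)\<^sup>2 / N" for i
    define Z where "Z = {i\<in>A. w $ i - \<delta> i < 1/2}"
    have ZA: "Z \<subseteq> A" "finite Z" using finA by (auto simp: Z_def)
    have split: "M = (\<Sum>i\<in>A - Z. (w $ i * x $ i)\<^sup>2) + (\<Sum>i\<in>Z. (w $ i * x $ i)\<^sup>2)"
      unfolding M_def by (rule sum.subset_diff[OF ZA(1) finA])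
    have w'Z: "w' $ i = 0" if "i \<in> Z" for i
      using that update_weights_nth[OF w, of i c x] by (auto simp: Z_def A w' \<delta>_def N_def Let_def)
    have w'A: "w' $ i = w $ i - \<delta> i" if "i \<in> A - Z" for i
      using that update_weights_nth[OF w, of i c x] by (auto simp: Z_def A w' \<delta>_def N_def Let_def)
    \<comment> \<open>At least half of \<open>M\<close> lies on coordinates of \<open>A\<close>
      whose weight survives, or on those that are cut. In the first case the weight of
      \<open>A\<close> drops by at least c (M/2) / N, so that the 12 of \<open>NM\<close> becomes
      24. In the second the regularizer at the unchanged point \<open>x\<close> drops by at least
      \<beta> M / 4, and the 6 of \<open>b2\<close> becomes 24.\<close>
    show ?thesis
    proof (cases "M / 2 \<le> (\<Sum>i\<in>A - Z. (w $ i * x $ i)\<^sup>2)")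
      case True
      have Npos: "0 < N"
      proof (rule ccontr)
        assume "\<not> 0 < N"
        then have "(\<Sum>i<n. w $ i * (x $ i)\<^sup>2) = 0" using N0 car by (simp add: N_def wnorm_sq_def)
        then have "\<forall>i<n. w $ i * (x $ i)\<^sup>2 = 0"
          using admissible_weights_bounds[OF w] by (subst (asm) sum_nonneg_eq_0_iff) auto
        then have "M = 0" unfolding M_def A by (intro sum.neutral) auto
        then show False using Mpos by simp
      qed
      have "(\<Sum>i\<in>A. w $ i - w' $ i) = (\<Sum>i\<in>A - Z. w $ i - w' $ i) + (\<Sum>i\<in>Z. w $ i - w' $ i)"
        by (rule sum.subset_diff[OF ZA(1) finA])
      moreover have "0 \<le> (\<Sum>i\<in>Z. w $ i - w' $ i)"
        using w'_le by (intro sum_nonneg) (auto simp: Z_def A)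
      moreover have "(\<Sum>i\<in>A - Z. w $ i - w' $ i) = c * (\<Sum>i\<in>A - Z. (w $ i * x $ i)\<^sup>2) / N"
        unfolding sum_distrib_left sum_divide_distrib by (rule sum.cong) (auto simp: w'A \<delta>_def)
      moreover have "c * (M / 2) / N \<le> c * (\<Sum>i\<in>A - Z. (w $ i * x $ i)\<^sup>2) / N"
        using True c Npos by (intro divide_right_mono mult_left_mono) auto
      moreover have "c / (24 * \<kappa>) \<le> c * (M / 2) / N"
      proof -
        have "c * N \<le> c * (12 * \<kappa> * M)" using NM c by (intro mult_left_mono)
        then show ?thesis using Npos \<kappa>1 by (simp add: field_simps)
      qed
      ultimately show ?thesis by (simp add: sum_subtractf)
    next
      case False
      then have ZM: "M / 2 \<le> (\<Sum>i\<in>Z. (w $ i * x $ i)\<^sup>2)" using split by linarith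
      have "wnorm_sq w x - wnorm_sq w' x = (\<Sum>i<n. (w $ i - w' $ i) * (x $ i)\<^sup>2)"
        using car by (simp add: wnorm_sq_def sum_subtractf left_diff_distrib)
      moreover have "(\<Sum>i\<in>Z. (w $ i - w' $ i) * (x $ i)\<^sup>2) \<le> (\<Sum>i<n. (w $ i - w' $ i) * (x $ i)\<^sup>2)"
        using w'_le by (intro sum_mono2) (auto simp: Z_def A)
      moreover have "(\<Sum>i\<in>Z. (w $ i - w' $ i) * (x $ i)\<^sup>2) \<ge> (\<Sum>i\<in>Z. (w $ i * x $ i)\<^sup>2)"
      proof (rule sum_mono)
        fix i assume i: "i \<in> Z"
        then have "w $ i * w $ i \<le> w $ i * 1"
          using admissible_weights_bounds[OF w, of i] by (intro mult_left_mono) (auto simp: Z_def A)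
        then have "(w $ i * w $ i) * (x $ i)\<^sup>2 \<le> (w $ i) * (x $ i)\<^sup>2" by (intro mult_right_mono) auto
        then show "(w $ i * x $ i)\<^sup>2 \<le> (w $ i - w' $ i) * (x $ i)\<^sup>2"
          by (simp add: w'Z[OF i] power2_eq_square mult_ac)
      qed
      ultimately have "M / 2 \<le> wnorm_sq w x - wnorm_sq w' x" using ZM by linarith
      then have "\<beta> / 2 * (M / 2) \<le> \<beta> / 2 * (wnorm_sq w x - wnorm_sq w' x)" using \<beta> by (intro mult_left_mono) auto
      then have "\<Delta>' \<le> \<Delta> - \<beta> * M / 4" using min(1) unfolding \<Delta> by (simp add: algebra_simps)
      also have "\<dots> \<le> \<Delta> - \<Delta> / (6 * \<kappa>) / 4" using b2 by simp
      also have "\<dots> = (1 - 1 / (24 * \<kappa>)) * \<Delta>" by (simp add: algebra_simps)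
      finally show ?thesis ..
    qed
  qed
qed

text \<open>A stalled iteration lowers the weight of \<open>A\<close> by c/(24 \<kappa>), and
  \<open>s\<close> bounds its initial weight, so the exponent discounts every stalled iteration. The
  estimate is restricted to positive \<open>\<Delta> t\<close> because multiplication by a factor
  below 1 does not decrease a negative gap.\<close>

lemma riht_run_invariant:
  fixes f :: "real vec \<Rightarrow> real" and x0 xs :: "real vec"
  assumes sm: "smooth n \<beta> f" and sc: "strongly_convex n \<alpha> f"
    and car: "x0 \<in> carrier_vec n" "xs \<in> carrier_vec n"
    and \<alpha>: "0 < \<alpha>" "\<alpha> \<le> \<beta>"
    and run: "riht_run n f s' (1 / (2 * \<beta>)) c T x0 X W"
    and sp: "sparse s' x0" "sparse s xs" "1 \<le> s"
    and \<kappa>: "\<kappa> = \<beta> / \<alpha>" and s': "258 * real s * \<kappa> \<le> real s'"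
    and T: "T \<ge> 1" and c: "c = real s' / (4 * real T)"
    and \<Delta>: "\<And>t. \<Delta> t = f (X t) + \<beta>/2 * wnorm_sq (W t) (X t) - f xs"
    and A: "A = {i. i < n \<and> xs $ i \<noteq> 0}"
    and t: "t \<le> T"
  shows "X t \<in> carrier_vec n \<and> sparse s' (X t) \<and> admissible_weights n (W t) \<and> lost_weight n (W t) \<le> c * real t
    \<and> \<Delta> t \<le> \<Delta> 0 \<and>
    (0 < \<Delta> t \<longrightarrow> \<Delta> t \<le> \<Delta> 0 * exp (- (real t - 24 * \<kappa> / c * (real s - (\<Sum>i\<in>A. W t $ i))) / (24 * \<kappa>)))"
  using t
proof (induction t)
  case 0
  have \<kappa>1: "\<kappa> \<ge> 1" using \<alpha> by (auto simp: \<kappa>)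
  have s'pos: "0 < real s'" using s' sp(3) \<kappa>1 by (smt (verit) mult_less_cancel_left1 of_nat_1 of_nat_mono mult_pos_pos)
  have init: "X 0 = x0" "W 0 = vec n (\<lambda>_. 1)" using run unfolding riht_run_def by auto
  have "(\<Sum>i\<in>A. W 0 $ i) = (\<Sum>i\<in>A. 1)" by (rule sum.cong) (auto simp: init A)
  also have "\<dots> \<le> real s" using sp(2) car by (auto simp: sparse_def A)
  finally have q: "0 \<le> 24 * \<kappa> / c * (real s - (\<Sum>i\<in>A. W 0 $ i))"
    using \<kappa>1 s'pos by (auto simp: c)
  moreover have "lost_weight n (W 0) = 0" by (simp add: lost_weight_def init)
  moreover have "\<Delta> 0 * 1 \<le> \<Delta> 0 * exp (- (real 0 - 24 * \<kappa> / c * (real s - (\<Sum>i\<in>A. W 0 $ i))) / (24 * \<kappa>))"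
    if "0 < \<Delta> 0"
  proof -
    have "0 \<le> - (real 0 - q) / (24 * \<kappa>)" if "0 \<le> q" for q using that \<kappa>1 by simp
    from this[OF q] show ?thesis using that by (intro mult_left_mono) (simp_all only: one_le_exp_iff less_imp_le)
  qed
  moreover have "X 0 \<in> carrier_vec n" "sparse s' (X 0)" "admissible_weights n (W 0)"
    using car sp by (auto simp: init admissible_weights_def)
  ultimately show ?case by auto
next
  case (Suc t)
  have \<kappa>1: "\<kappa> \<ge> 1" using \<alpha> by (auto simp: \<kappa>)
  have s'pos: "0 < real s'" using s' sp(3) \<kappa>1 by (smt (verit) mult_less_cancel_left1 of_nat_1 of_nat_mono mult_pos_pos)
  have cpos: "0 < c" using s'pos T by (simp add: c)
  have IH: "X t \<in> carrier_vec n" "sparse s' (X t)" "admissible_weights n (W t)" "lost_weight n (W t) \<le> c * real t"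
    "\<Delta> t \<le> \<Delta> 0"
    "0 < \<Delta> t \<Longrightarrow> \<Delta> t \<le> \<Delta> 0 * exp (- (real t - 24 * \<kappa> / c * (real s - (\<Sum>i\<in>A. W t $ i))) / (24 * \<kappa>))"
    using Suc by auto
  have step: "riht_step n f s' (1 / (2 * \<beta>)) c (X t) (W t) (X (Suc t)) (W (Suc t))"
    using run Suc.prems unfolding riht_run_def by auto
  have lost: "lost_weight n (W t) \<le> real s' / 4"
  proof -
    have "c * real t \<le> c * real T" using cpos Suc.prems by simp
    also have "\<dots> = real s' / 4" using T by (simp add: c)
    finally show ?thesis using IH(4) by linarith
  qed
  note P = riht_step_progress[OF sm sc IH(1) car(2) \<alpha> less_imp_le[OF cpos] step IH(3) lost IH(2) sp(2,3) \<kappa> s' \<Delta> \<Delta> A]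
  have "\<Delta> (Suc t) \<le> \<Delta> 0 * exp (- (real (Suc t) - 24 * \<kappa> / c * (real s - (\<Sum>i\<in>A. W (Suc t) $ i))) / (24 * \<kappa>))"
    if pos: "0 < \<Delta> (Suc t)"
  proof -
    define a where "a = 1 / (24 * \<kappa>)"
    have a: "0 \<le> a" using \<kappa>1 by (simp add: a_def)
    \<comment> \<open>The exponent is split into -r/(24 \<kappa>) and the weight lost divided by
      \<open>c\<close>, so that stalled iterations are balanced by the second summand.\<close>
    have e: "exp (- (r - 24 * \<kappa> / c * (real s - q)) / (24 * \<kappa>)) = exp (- a * r + (real s - q) / c)" for r q
      using \<kappa>1 cpos by (simp add: a_def field_simps)
    have pos': "0 < \<Delta> t" using P(5) pos by linarith
    have \<Delta>0: "0 < \<Delta> 0" using IH(5) pos' by linarith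
    have I: "\<Delta> t \<le> \<Delta> 0 * exp (- a * real t + (real s - (\<Sum>i\<in>A. W t $ i)) / c)"
      using IH(6)[OF pos'] unfolding e .
    have "\<Delta> (Suc t) \<le> \<Delta> 0 * exp (- a * real (Suc t) + (real s - (\<Sum>i\<in>A. W (Suc t) $ i)) / c)"
    proof (cases "\<Delta> (Suc t) \<le> (1 - a) * \<Delta> t")
      case True
      also have "(1 - a) * \<Delta> t \<le> exp (- a) * \<Delta> t"
        using pos' exp_ge_add_one_self[of "- a"] by (intro mult_right_mono) auto
      also have "\<dots> \<le> exp (- a) * (\<Delta> 0 * exp (- a * real t + (real s - (\<Sum>i\<in>A. W t $ i)) / c))"
        using I by (intro mult_left_mono) auto
      also have "\<dots> = \<Delta> 0 * exp (- a * real (Suc t) + (real s - (\<Sum>i\<in>A. W t $ i)) / c)"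
        by (simp add: exp_add[symmetric] mult.left_commute algebra_simps)
      also have "\<dots> \<le> \<Delta> 0 * exp (- a * real (Suc t) + (real s - (\<Sum>i\<in>A. W (Suc t) $ i)) / c)"
        using \<Delta>0 P(6) cpos by (auto intro!: mult_left_mono divide_right_mono)
      finally show ?thesis .
    next
      case False
      \<comment> \<open>The stalled case: \<Delta> does not grow, and the drop in weight raises the
        second summand of the exponent by at least the amount \<open>a\<close> by which the first
        one falls.\<close>
      then have "(\<Sum>i\<in>A. W (Suc t) $ i) \<le> (\<Sum>i\<in>A. W t $ i) - c * a"
        using P(7) pos' by (auto simp: a_def)
      then have "(real s - (\<Sum>i\<in>A. W t $ i) + c * a) / c \<le> (real s - (\<Sum>i\<in>A. W (Suc t) $ i)) / c"
        using cpos by (intro divide_right_mono) auto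
      then have "(real s - (\<Sum>i\<in>A. W t $ i)) / c + a \<le> (real s - (\<Sum>i\<in>A. W (Suc t) $ i)) / c"
        using cpos by (simp add: add_divide_distrib)
      then have "- a * real t + (real s - (\<Sum>i\<in>A. W t $ i)) / c \<le> - a * real (Suc t) + (real s - (\<Sum>i\<in>A. W (Suc t) $ i)) / c"
        by (simp add: algebra_simps)
      then have "\<Delta> 0 * exp (- a * real t + (real s - (\<Sum>i\<in>A. W t $ i)) / c)
         \<le> \<Delta> 0 * exp (- a * real (Suc t) + (real s - (\<Sum>i\<in>A. W (Suc t) $ i)) / c)"
        using \<Delta>0 by (intro mult_left_mono) auto
      then show ?thesis using I P(5) by linarith
    qed
    then show ?thesis unfolding e .
  qed
  moreover have "lost_weight n (W (Suc t)) \<le> c * real (Suc t)" using P(4) IH(4) by (simp add: algebra_simps)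
  ultimately show ?case using P(1-3,5) IH(5) by auto
qed

text \<open>Since s' \<ge> 192 s \<kappa>, stalling can account for at most half of the iterations;
  the other T/2 contract at rate 1/(24 \<kappa>), whence the factor 48 in the number of
  iterations.\<close>

lemma riht_run_converges:
  fixes f :: "real vec \<Rightarrow> real" and x0 xs :: "real vec"
  assumes sm: "smooth n \<beta> f" and sc: "strongly_convex n \<alpha> f"
    and car: "x0 \<in> carrier_vec n" "xs \<in> carrier_vec n"
    and \<alpha>: "0 < \<alpha>" "\<alpha> \<le> \<beta>"
    and run: "riht_run n f s' (1 / (2 * \<beta>)) c T x0 X W"
    and sp: "sparse s' x0" "sparse s xs" "1 \<le> s"
    and \<kappa>: "\<kappa> = \<beta> / \<alpha>" and s': "258 * real s * \<kappa> \<le> real s'"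
    and T: "T \<ge> 1" and c: "c = real s' / (4 * real T)"
    and gap: "gap = f x0 + \<beta> / 2 * (norm2 x0)\<^sup>2 - f xs" and \<epsilon>: "\<epsilon> > 0"
    and T': "gap > \<epsilon> \<Longrightarrow> 48 * \<kappa> * ln (gap / \<epsilon>) \<le> real T"
  shows "f (X T) \<le> f xs + \<epsilon>"
proof -
  define \<Delta> where "\<Delta> t = f (X t) + \<beta>/2 * wnorm_sq (W t) (X t) - f xs" for t
  define A where "A = {i. i < n \<and> xs $ i \<noteq> 0}"
  have \<kappa>1: "\<kappa> \<ge> 1" and \<beta>: "\<beta> > 0" using \<alpha> by (auto simp: \<kappa>)
  have init: "X 0 = x0" "W 0 = vec n (\<lambda>_. 1)" using run unfolding riht_run_def by auto
  \<comment> \<open>All initial weights are 1, so the initial regularizer is the plain squared norm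
    that occurs in \<open>gap\<close>.\<close>
  have "wnorm_sq (W 0) x0 = (norm2 x0)\<^sup>2"
    unfolding norm2_sq wnorm_sq_def using car by (intro sum.cong) (auto simp: init)
  then have \<Delta>0: "\<Delta> 0 = gap" by (simp add: \<Delta>_def gap init)
  have inv: "X T \<in> carrier_vec n" "admissible_weights n (W T)" "\<Delta> T \<le> \<Delta> 0"
    "0 < \<Delta> T \<Longrightarrow> \<Delta> T \<le> \<Delta> 0 * exp (- (real T - 24 * \<kappa> / c * (real s - (\<Sum>i\<in>A. W T $ i))) / (24 * \<kappa>))"
    using riht_run_invariant[OF sm sc car \<alpha> run sp \<kappa> s' T c \<Delta>_def A_def order_refl] by auto
  have "0 \<le> \<beta>/2 * wnorm_sq (W T) (X T)" using \<beta> wnorm_sq_nonneg[OF inv(2,1)] by simp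
  then have fT: "f (X T) \<le> f xs + \<Delta> T" by (simp add: \<Delta>_def)
  have "\<Delta> T \<le> \<epsilon>"
  proof (cases "gap > \<epsilon> \<and> \<Delta> T > 0")
    case False
    then show ?thesis using inv(3) \<epsilon> \<Delta>0 by linarith
  next
    case True
    have s\<kappa>: "1 \<le> real s * \<kappa>" using sp(3) \<kappa>1 mult_mono[of 1 "real s" 1 \<kappa>] by simp
    then have s'pos: "0 < real s'" using s' by linarith
    have W0: "0 \<le> (\<Sum>i\<in>A. W T $ i)"
      using admissible_weights_bounds(1)[OF inv(2)] by (intro sum_nonneg) (auto simp: A_def)
    have cpos: "0 < c" using s'pos T by (simp add: c)
    have "24 * \<kappa> / c * (real s - (\<Sum>i\<in>A. W T $ i)) \<le> 24 * \<kappa> / c * real s"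
      using W0 \<kappa>1 cpos by (intro mult_left_mono) auto
    also have "\<dots> = 96 * (real s * \<kappa>) * real T / real s'" using T s'pos by (simp add: c field_simps)
    also have "\<dots> \<le> real T / 2"
    proof -
      have "192 * (real s * \<kappa>) \<le> real s'" using s' s\<kappa> by linarith
      then have "192 * (real s * \<kappa>) * real T \<le> real s' * real T" by (intro mult_right_mono) auto
      then show ?thesis using s'pos by (simp add: field_simps)
    qed
    finally have "real T / 2 \<le> real T - 24 * \<kappa> / c * (real s - (\<Sum>i\<in>A. W T $ i))" by linarith
    then have "(real T / 2) / (24 * \<kappa>) \<le> (real T - 24 * \<kappa> / c * (real s - (\<Sum>i\<in>A. W T $ i))) / (24 * \<kappa>)"
      using \<kappa>1 by (intro divide_right_mono) auto
    moreover have "ln (gap / \<epsilon>) \<le> (real T / 2) / (24 * \<kappa>)"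
      using T' True \<kappa>1 by (simp add: field_simps)
    ultimately have "- (real T - 24 * \<kappa> / c * (real s - (\<Sum>i\<in>A. W T $ i))) / (24 * \<kappa>) \<le> - ln (gap / \<epsilon>)"
      by (simp only: minus_divide_left[symmetric])
    then have "gap * exp (- (real T - 24 * \<kappa> / c * (real s - (\<Sum>i\<in>A. W T $ i))) / (24 * \<kappa>)) \<le> gap * exp (- ln (gap / \<epsilon>))"
      using True \<epsilon> by (intro mult_left_mono) auto
    also have "\<dots> = \<epsilon>" using True \<epsilon> by (simp add: exp_minus)
    finally show ?thesis using inv(4) True unfolding \<Delta>0 by linarith
  qed
  then show ?thesis using fT by linarith
qed

section \<open>A linear-time program for one iteration\<close>

text \<open>The list form of \<open>encode_vec\<close>, suited to structural induction; it also
  encodes intermediate lists whose length is not \<open>n\<close>.\<close>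

definition encode_list :: "real list \<Rightarrow> val" where
  "encode_list l = foldr (\<lambda>a. VCons (VNum a)) l VNil"

lemma encode_list_simps [simp]:
  "encode_list [] = VNil"
  "encode_list (a # l) = VCons (VNum a) (encode_list l)"
  by (simp_all add: encode_list_def)

lemma encode_list_eq_VNil [simp]: "encode_list l = VNil \<longleftrightarrow> l = []"
  by (cases l) auto

lemma encode_vec_list: "encode_vec v = encode_list (list_of_vec v)"
  by (simp add: encode_vec_def encode_list_def)

text \<open>\<open>Call k\<close> refers to position \<open>k\<close> of \<open>iht_procs\<close> below.\<close>
definition len_body :: expr where
  "len_body = IfNil (Var 0) (Lit 0) (Arith Plus (Lit 1) (Call 0 (CdrE (Var 0))))"

definition median3_expr :: "expr \<Rightarrow> expr \<Rightarrow> expr \<Rightarrow> expr" where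
  "median3_expr a b c = IfLess a b (IfLess b c b (IfLess a c c a)) (IfLess a c a (IfLess b c c b))"

definition medians_body :: expr where
  "medians_body = IfNil (Var 0) NilE (IfNil (CdrE (Var 0)) NilE (IfNil (CdrE (CdrE (Var 0))) NilE
     (LetE (CarE (Var 0)) (LetE (CarE (CdrE (Var 1))) (LetE (CarE (CdrE (CdrE (Var 2))))
       (ConsE (median3_expr (Var 2) (Var 1) (Var 0)) (Call 1 (CdrE (CdrE (CdrE (Var 3)))))))))))"

definition greater_body :: expr where
  "greater_body = IfNil (CdrE (Var 0)) NilE
     (LetE (Call 2 (ConsE (CarE (Var 0)) (CdrE (CdrE (Var 0)))))
       (IfLess (CarE (Var 1)) (CarE (CdrE (Var 1))) (ConsE (CarE (CdrE (Var 1))) (Var 0)) (Var 0)))"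

definition less_body :: expr where
  "less_body = IfNil (CdrE (Var 0)) NilE
     (LetE (Call 3 (ConsE (CarE (Var 0)) (CdrE (CdrE (Var 0)))))
       (IfLess (CarE (CdrE (Var 1))) (CarE (Var 1)) (ConsE (CarE (CdrE (Var 1))) (Var 0)) (Var 0)))"

text \<open>Expects the environment: pivot, medians of medians, rank, list, original argument. Ranks
  count from the largest entry. If fewer than \<open>k\<close> entries exceed the pivot, the number
  of entries not below it is computed as a difference of lengths and decides between returning the
  pivot and searching the smaller entries with reduced rank.\<close>

definition recurse_expr :: expr where
  "recurse_expr = LetE (Call 2 (ConsE (Var 0) (Var 3)))
     (IfLess (Call 0 (Var 0)) (Var 3)
       (LetE (Call 3 (ConsE (Var 1) (Var 4)))
         (LetE (Arith Minus (Call 0 (Var 5)) (Call 0 (Var 0)))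
           (IfLess (Var 0) (Var 5) (Call 4 (ConsE (Var 1) (Arith Minus (Var 5) (Var 0)))) (Var 3))))
       (Call 4 (ConsE (Var 0) (Var 3))))"

text \<open>No base case is needed: if there are no medians of medians, the head serves as pivot,
  and the pivot itself belongs to neither recursive list.\<close>

definition select_body :: expr where
  "select_body = LetE (CarE (Var 0)) (LetE (CdrE (Var 1))
     (LetE (Call 1 (Call 1 (Var 1)))
     (LetE (IfNil (Var 0) (CarE (Var 2)) (Call 4 (ConsE (Var 0) (Arith Divide (Call 0 (Var 0)) (Lit 2)))))
       recurse_expr)))"

definition descent_body :: expr where
  "descent_body = IfNil (CarE (Var 0)) NilE
     (ConsE (Arith Minus
         (Arith Times (Arith Minus (Lit 1) (Arith Times (Arith Divide (Lit 1) (Lit 2)) (CarE (CarE (CdrE (Var 0))))))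
           (CarE (CarE (Var 0))))
         (Arith Times (CdrE (CdrE (CdrE (Var 0)))) (CarE (CarE (CdrE (CdrE (Var 0)))))))
       (Call 5 (ConsE (CdrE (CarE (Var 0))) (ConsE (CdrE (CarE (CdrE (Var 0))))
         (ConsE (CdrE (CarE (CdrE (CdrE (Var 0))))) (CdrE (CdrE (CdrE (Var 0)))))))))"

definition squares_body :: expr where
  "squares_body = IfNil (Var 0) NilE
     (ConsE (Arith Times (CarE (Var 0)) (CarE (Var 0))) (Call 6 (CdrE (Var 0))))"

definition keep_body :: expr where
  "keep_body = IfNil (CarE (Var 0)) NilE (LetE (CarE (CarE (Var 0)))
     (IfLess (CarE (CdrE (Var 1))) (Arith Times (Var 0) (Var 0))
       (ConsE (Var 0) (Call 7 (ConsE (CdrE (CarE (Var 1))) (CdrE (Var 1)))))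
       (IfLess (Arith Times (Var 0) (Var 0)) (CarE (CdrE (Var 1)))
         (ConsE (Lit 0) (Call 7 (ConsE (CdrE (CarE (Var 1))) (CdrE (Var 1)))))
         (IfLess (CdrE (CdrE (Var 1))) (Lit 1)
           (ConsE (Lit 0) (Call 7 (ConsE (CdrE (CarE (Var 1))) (CdrE (Var 1)))))
           (ConsE (Var 0) (Call 7 (ConsE (CdrE (CarE (Var 1)))
             (ConsE (CarE (CdrE (Var 1))) (Arith Minus (CdrE (CdrE (Var 1))) (Lit 1))))))))))"

definition wnorm_body :: expr where
  "wnorm_body = IfNil (CdrE (Var 0)) (Lit 0)
     (Arith Plus (Arith Times (CarE (CarE (Var 0))) (Arith Times (CarE (CdrE (Var 0))) (CarE (CdrE (Var 0)))))
       (Call 8 (ConsE (CdrE (CarE (Var 0))) (CdrE (CdrE (Var 0))))))"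

definition reweight_body :: expr where
  "reweight_body = IfNil (CarE (Var 0)) NilE
     (LetE (Arith Times (CarE (CarE (Var 0))) (CarE (CarE (CdrE (Var 0)))))
     (LetE (Arith Minus (CarE (CarE (Var 1)))
         (Arith Divide (Arith Times (CarE (CdrE (CdrE (Var 1)))) (Arith Times (Var 0) (Var 0))) (CdrE (CdrE (CdrE (Var 1))))))
       (ConsE (IfLess (Var 0) (Arith Divide (Lit 1) (Lit 2)) (Lit 0) (Var 0))
         (Call 9 (ConsE (CdrE (CarE (Var 2))) (ConsE (CdrE (CarE (CdrE (Var 2)))) (CdrE (CdrE (Var 2)))))))))"

definition iht_procs :: "expr list" where
  "iht_procs = [len_body, medians_body, greater_body, less_body, select_body, descent_body,
     squares_body, keep_body, wnorm_body, reweight_body]"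

definition objective_expr :: "expr \<Rightarrow> expr" where
  "objective_expr v = Arith Plus (EvalF v)
     (Arith Times (Arith Divide (Lit 1) (Arith Times (Lit 4) (Var 11))) (Call 8 (ConsE (Var 0) v)))"

definition reweight_expr :: expr where
  "reweight_expr = Call 9 (ConsE (Var 8) (ConsE (Var 7) (ConsE (Var 11) (Var 0))))"

text \<open>Each \<open>LetE\<close> pushes one value onto x, w, s', \<eta>, c: in turn z, its
  squares, n, the minimum of n and s', the threshold, y, the weighted norm and w'. Squares stand in
  for absolute values, having the same order. A test for zero takes two comparisons because only
  strict ones exist.\<close>

definition iht_main :: expr where
  "iht_main =
     LetE (Call 5 (ConsE (Var 0) (ConsE (Var 1) (ConsE (EvalGrad (Var 0)) (Var 3)))))
     (LetE (Call 6 (Var 0))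
     (LetE (Call 0 (Var 0))
     (LetE (IfLess (Var 0) (Var 5) (Var 0) (Var 5))
     (LetE (Call 4 (ConsE (Var 2) (Var 0)))
     (LetE (Call 7 (ConsE (Var 4) (ConsE (Var 0) (Arith Minus (Var 1) (Call 0 (Call 2 (ConsE (Var 0) (Var 3))))))))
     (LetE (Call 8 (ConsE (Var 7) (Var 6)))
     (LetE (IfLess (Var 0) (Lit 0) reweight_expr (IfLess (Lit 0) (Var 0) reweight_expr (Var 8)))
       (IfLess (objective_expr (Var 8)) (objective_expr (Var 2)) (ConsE (Var 8) (Var 0)) (ConsE (Var 2) (Var 0))))))))))"

lemma length_iht_procs [simp]: "length iht_procs = 10"
  by (simp add: iht_procs_def)

fun median3 :: "real \<Rightarrow> real \<Rightarrow> real \<Rightarrow> real" where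
  "median3 a b c = (if a < b then if b < c then b else if a < c then c else a
     else if a < c then a else if b < c then c else b)"

fun medians :: "real list \<Rightarrow> real list" where
  "medians (a # b # c # l) = median3 a b c # medians l"
| "medians _ = []"

text \<open>\<open>r\<close> is the remaining quota of entries whose square equals
  \<open>\<tau>\<close>; it is real because the machine computes with reals.\<close>

fun keep :: "real \<Rightarrow> real \<Rightarrow> real list \<Rightarrow> real list" where
  "keep \<tau> r [] = []"
| "keep \<tau> r (h # l) = (if \<tau> < h * h then h # keep \<tau> r l else if h * h < \<tau> then 0 # keep \<tau> r l
     else if r < 1 then 0 # keep \<tau> r l else h # keep \<tau> (r - 1) l)"

section \<open>Weakest preconditions for the cost model\<close>

context
  fixes n :: nat and f :: "real vec \<Rightarrow> real" and g :: "real vec \<Rightarrow> real vec"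
begin

definition calls :: "nat \<Rightarrow> val \<Rightarrow> (val \<Rightarrow> nat \<Rightarrow> nat \<Rightarrow> nat \<Rightarrow> bool) \<Rightarrow> bool" where
  "calls k u R \<longleftrightarrow> k < length iht_procs \<and>
     (\<exists>v p q t. exec iht_procs n f g [u] (iht_procs ! k) v p q t \<and> R v p q t)"

text \<open>Only an upper bound on the time is recorded, so that specifications compose without the
  exact times of \<open>exec\<close>.\<close>

definition computes :: "nat \<Rightarrow> val \<Rightarrow> val \<Rightarrow> nat \<Rightarrow> bool" where
  "computes k u v b \<longleftrightarrow> calls k u (\<lambda>v' p q t. v' = v \<and> p = 0 \<and> q = 0 \<and> t \<le> b)"

text \<open>Keeps the simplifier out of the continuation \<open>R\<close>, so that symbolic
  execution pauses at a call until its specification is applied.\<close>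

lemma calls_weak_cong [cong]: "u = u' \<Longrightarrow> calls k u R = calls k u' R"
  by simp

lemma calls_computes:
  assumes "computes k u v b" "\<And>t. t \<le> b \<Longrightarrow> R v 0 0 t"
  shows "calls k u R"
  using assms unfolding computes_def calls_def by blast

text \<open>A weakest precondition in continuation-passing style, so that rewriting with its defining
  equations executes straight-line code symbolically.\<close>
primrec wp :: "expr \<Rightarrow> val list \<Rightarrow> (val \<Rightarrow> nat \<Rightarrow> nat \<Rightarrow> nat \<Rightarrow> bool) \<Rightarrow> bool" where
  "wp (Var i) env Q \<longleftrightarrow> i < length env \<and> Q (env ! i) 0 0 1"
| "wp (Lit k) env Q \<longleftrightarrow> Q (VNum (of_int k)) 0 0 1"
| "wp (Arith bop e1 e2) env Q \<longleftrightarrow> wp e1 env (\<lambda>u p1 q1 t1. wp e2 env (\<lambda>v p2 q2 t2.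
     case u of VNum a \<Rightarrow> (case v of VNum b \<Rightarrow> Q (VNum (arith_op bop a b)) (p1 + p2) (q1 + q2) (t1 + t2 + 1)
       | _ \<Rightarrow> False) | _ \<Rightarrow> False))"
| "wp NilE env Q \<longleftrightarrow> Q VNil 0 0 1"
| "wp (ConsE e1 e2) env Q \<longleftrightarrow> wp e1 env (\<lambda>u p1 q1 t1. wp e2 env (\<lambda>v p2 q2 t2.
     Q (VCons u v) (p1 + p2) (q1 + q2) (t1 + t2 + 1)))"
| "wp (CarE e) env Q \<longleftrightarrow> wp e env (\<lambda>r p q t. case r of VCons u v \<Rightarrow> Q u p q (t + 1) | _ \<Rightarrow> False)"
| "wp (CdrE e) env Q \<longleftrightarrow> wp e env (\<lambda>r p q t. case r of VCons u v \<Rightarrow> Q v p q (t + 1) | _ \<Rightarrow> False)"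
| "wp (IfLess e1 e2 e3 e4) env Q \<longleftrightarrow> wp e1 env (\<lambda>u p1 q1 t1. wp e2 env (\<lambda>v p2 q2 t2.
     case u of VNum a \<Rightarrow> (case v of VNum b \<Rightarrow>
       if a < b then wp e3 env (\<lambda>r p3 q3 t3. Q r (p1 + p2 + p3) (q1 + q2 + q3) (t1 + t2 + t3 + 1))
       else wp e4 env (\<lambda>r p3 q3 t3. Q r (p1 + p2 + p3) (q1 + q2 + q3) (t1 + t2 + t3 + 1))
       | _ \<Rightarrow> False) | _ \<Rightarrow> False))"
| "wp (IfNil e1 e2 e3) env Q \<longleftrightarrow> wp e1 env (\<lambda>u p1 q1 t1.
     (if u = VNil then wp e2 env (\<lambda>r p2 q2 t2. Q r (p1 + p2) (q1 + q2) (t1 + t2 + 1))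
      else wp e3 env (\<lambda>r p2 q2 t2. Q r (p1 + p2) (q1 + q2) (t1 + t2 + 1))))"
| "wp (LetE e1 e2) env Q \<longleftrightarrow> wp e1 env (\<lambda>u p1 q1 t1. wp e2 (u # env) (\<lambda>v p2 q2 t2.
     Q v (p1 + p2) (q1 + q2) (t1 + t2 + 1)))"
| "wp (Call k e) env Q \<longleftrightarrow> wp e env (\<lambda>u p1 q1 t1. calls k u (\<lambda>v p2 q2 t2.
     Q v (p1 + p2) (q1 + q2) (t1 + t2 + 1)))"
| "wp (EvalF e) env Q \<longleftrightarrow> wp e env (\<lambda>u p q t. \<exists>x\<in>carrier_vec n. u = encode_vec x \<and> Q (VNum (f x)) (p + 1) q (t + 1))"
| "wp (EvalGrad e) env Q \<longleftrightarrow> wp e env (\<lambda>u p q t. \<exists>x\<in>carrier_vec n. u = encode_vec x \<and> Q (encode_vec (g x)) p (q + 1) (t + 1))"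

text \<open>Induction on the expression alone suffices, because \<open>calls\<close> refers to
  \<open>exec\<close> directly and thereby cuts off the recursion through procedure bodies.\<close>

lemma wp_sound:
  "wp e env Q \<Longrightarrow> \<exists>v p q t. exec iht_procs n f g env e v p q t \<and> Q v p q t"
proof (induction e arbitrary: env Q)
  case (Var i) then show ?case by (metis exec.Var wp.simps(1))
next
  case (Lit k) then show ?case by (metis exec.Lit wp.simps(2))
next
  case (Arith bop e1 e2)
  from Arith.IH(1)[OF Arith.prems[unfolded wp.simps]] obtain u p1 q1 t1 where
    1: "exec iht_procs n f g env e1 u p1 q1 t1" and *: "wp e2 env (\<lambda>v p2 q2 t2.
     case u of VNum a \<Rightarrow> (case v of VNum b \<Rightarrow> Q (VNum (arith_op bop a b)) (p1 + p2) (q1 + q2) (t1 + t2 + 1)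
       | _ \<Rightarrow> False) | _ \<Rightarrow> False)" by blast
  from Arith.IH(2)[OF *] obtain v p2 q2 t2 where
    2: "exec iht_procs n f g env e2 v p2 q2 t2" and
    c: "case u of VNum a \<Rightarrow> (case v of VNum b \<Rightarrow> Q (VNum (arith_op bop a b)) (p1 + p2) (q1 + q2) (t1 + t2 + 1)
       | _ \<Rightarrow> False) | _ \<Rightarrow> False" by blast
  then obtain a b where uv: "u = VNum a" "v = VNum b" by (cases u; cases v) auto
  show ?case using exec.Arith[OF 1[unfolded uv] 2[unfolded uv]] c[unfolded uv val.case] by blast
next
  case NilE then show ?case by (metis exec.NilE wp.simps(4))
next
  case (ConsE e1 e2)
  from ConsE.IH(1)[OF ConsE.prems[unfolded wp.simps]] obtain u p1 q1 t1 where
    1: "exec iht_procs n f g env e1 u p1 q1 t1" and "wp e2 env (\<lambda>v p2 q2 t2.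
     Q (VCons u v) (p1 + p2) (q1 + q2) (t1 + t2 + 1))" by blast
  from ConsE.IH(2)[OF this(2)] 1 show ?case by (metis exec.ConsE)
next
  case (CarE e)
  from CarE.IH[OF CarE.prems[unfolded wp.simps]] obtain r p q t where
    1: "exec iht_procs n f g env e r p q t" and 2: "case r of VCons u v \<Rightarrow> Q u p q (t + 1) | _ \<Rightarrow> False" by blast
  then obtain u v where r: "r = VCons u v" by (cases r) auto
  show ?case using exec.CarE[OF 1[unfolded r]] 2[unfolded r val.case] by blast
next
  case (CdrE e)
  from CdrE.IH[OF CdrE.prems[unfolded wp.simps]] obtain r p q t where
    1: "exec iht_procs n f g env e r p q t" and 2: "case r of VCons u v \<Rightarrow> Q v p q (t + 1) | _ \<Rightarrow> False" by blast
  then obtain u v where r: "r = VCons u v" by (cases r) auto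
  show ?case using exec.CdrE[OF 1[unfolded r]] 2[unfolded r val.case] by blast
next
  case (IfLess e1 e2 e3 e4)
  from IfLess.IH(1)[OF IfLess.prems[unfolded wp.simps]] obtain u p1 q1 t1 where
    1: "exec iht_procs n f g env e1 u p1 q1 t1" and *: "wp e2 env (\<lambda>v p2 q2 t2.
     case u of VNum a \<Rightarrow> (case v of VNum b \<Rightarrow>
       if a < b then wp e3 env (\<lambda>r p3 q3 t3. Q r (p1 + p2 + p3) (q1 + q2 + q3) (t1 + t2 + t3 + 1))
       else wp e4 env (\<lambda>r p3 q3 t3. Q r (p1 + p2 + p3) (q1 + q2 + q3) (t1 + t2 + t3 + 1))
       | _ \<Rightarrow> False) | _ \<Rightarrow> False)" by blast
  from IfLess.IH(2)[OF *] obtain v p2 q2 t2 where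
    2: "exec iht_procs n f g env e2 v p2 q2 t2" and
    c: "case u of VNum a \<Rightarrow> (case v of VNum b \<Rightarrow>
       if a < b then wp e3 env (\<lambda>r p3 q3 t3. Q r (p1 + p2 + p3) (q1 + q2 + q3) (t1 + t2 + t3 + 1))
       else wp e4 env (\<lambda>r p3 q3 t3. Q r (p1 + p2 + p3) (q1 + q2 + q3) (t1 + t2 + t3 + 1))
       | _ \<Rightarrow> False) | _ \<Rightarrow> False" by blast
  then obtain a b where uv: "u = VNum a" "v = VNum b" by (cases u; cases v) auto
  note 3 = c[unfolded uv val.case]
  have "\<exists>r p3 q3 t3. exec iht_procs n f g env (if a < b then e3 else e4) r p3 q3 t3 \<and>
      Q r (p1 + p2 + p3) (q1 + q2 + q3) (t1 + t2 + t3 + 1)"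
    using IfLess.IH(3,4) 3 by (cases "a < b") auto
  then show ?case using exec.IfLess[OF 1[unfolded uv] 2[unfolded uv]] by blast
next
  case (IfNil e1 e2 e3)
  from IfNil.IH(1)[OF IfNil.prems[unfolded wp.simps]] obtain u p1 q1 t1 where
    1: "exec iht_procs n f g env e1 u p1 q1 t1" and
    *: "if u = VNil then wp e2 env (\<lambda>r p2 q2 t2. Q r (p1 + p2) (q1 + q2) (t1 + t2 + 1))
      else wp e3 env (\<lambda>r p2 q2 t2. Q r (p1 + p2) (q1 + q2) (t1 + t2 + 1))" by blast
  have "\<exists>r p2 q2 t2. exec iht_procs n f g env (if u = VNil then e2 else e3) r p2 q2 t2 \<and>
      Q r (p1 + p2) (q1 + q2) (t1 + t2 + 1)"
    using IfNil.IH(2,3) * by (cases "u = VNil") auto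
  then show ?case using exec.IfNil[OF 1] by blast
next
  case (LetE e1 e2)
  from LetE.IH(1)[OF LetE.prems[unfolded wp.simps]] obtain u p1 q1 t1 where
    1: "exec iht_procs n f g env e1 u p1 q1 t1" and *: "wp e2 (u # env) (\<lambda>v p2 q2 t2.
     Q v (p1 + p2) (q1 + q2) (t1 + t2 + 1))" by blast
  from LetE.IH(2)[OF *] 1 show ?case by (metis exec.LetE)
next
  case (Call k e)
  from Call.IH[OF Call.prems[unfolded wp.simps]] show ?case
    unfolding calls_def by (metis exec.Call)
next
  case (EvalF e)
  from EvalF.IH[OF EvalF.prems[unfolded wp.simps]] show ?case by (metis exec.EvalF)
next
  case (EvalGrad e)
  from EvalGrad.IH[OF EvalGrad.prems[unfolded wp.simps]] show ?case by (metis exec.EvalGrad)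
qed

lemma callsI:
  assumes "k < length iht_procs" "wp (iht_procs ! k) [u] R"
  shows "calls k u R"
  using assms wp_sound unfolding calls_def by blast

section \<open>Running times of the list procedures\<close>

lemma computes_len: "computes 0 (encode_list l) (VNum (real (length l))) (10 * length l + 10)"
proof (induction l)
  case Nil
  show ?case unfolding computes_def
    by (rule callsI) (simp_all add: iht_procs_def len_body_def)
next
  case (Cons a l)
  show ?case unfolding computes_def
    apply (rule callsI, simp, simp add: iht_procs_def len_body_def)
    apply (rule calls_computes[OF Cons])
    apply simp
    done
qed

lemma computes_medians: "computes (Suc 0) (encode_list l) (encode_list (medians l)) (40 * length l + 40)"
proof (induction l rule: medians.induct)
  case (1 a b c l)
  have "computes (Suc 0) (encode_list l) (encode_list (medians l)) (40 * length l + 40)" using 1 by simp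
  note c = calls_computes[OF this]
  show ?case unfolding computes_def
    apply (rule callsI, simp, simp add: iht_procs_def medians_body_def median3_expr_def del: median3.simps)
    apply (auto intro!: c)
    done
qed (unfold computes_def, (rule callsI, simp, simp add: iht_procs_def medians_body_def)+)

lemma computes_greater:
  "computes 2 (VCons (VNum p) (encode_list l)) (encode_list (filter (\<lambda>x. p < x) l)) (30 * length l + 30)"
proof (induction l)
  case Nil
  show ?case unfolding computes_def
    by (rule callsI) (simp_all add: iht_procs_def greater_body_def)
next
  case (Cons a l)
  show ?case unfolding computes_def
    apply (rule callsI, simp, simp add: iht_procs_def greater_body_def)
    apply (auto intro!: calls_computes[OF Cons])
    done
qed

lemma computes_less:
  "computes 3 (VCons (VNum p) (encode_list l)) (encode_list (filter (\<lambda>x. x < p) l)) (30 * length l + 30)"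
proof (induction l)
  case Nil
  show ?case unfolding computes_def
    by (rule callsI) (simp_all add: iht_procs_def less_body_def)
next
  case (Cons a l)
  show ?case unfolding computes_def
    apply (rule callsI, simp, simp add: iht_procs_def less_body_def)
    apply (auto intro!: calls_computes[OF Cons])
    done
qed

lemma computes_descent:
  assumes "length xs = length ws" "length ws = length gs"
  shows "computes 5 (VCons (encode_list xs) (VCons (encode_list ws) (VCons (encode_list gs) (VNum \<eta>))))
    (encode_list (map (\<lambda>(x, w, d). (1 - 0.5 * w) * x - \<eta> * d) (zip xs (zip ws gs)))) (100 * length xs + 100)"
  using assms
proof (induction xs ws gs rule: list_induct3)
  case Nil
  show ?case unfolding computes_def
    by (rule callsI) (simp_all add: iht_procs_def descent_body_def)
next
  case (Cons x xs w ws d gs)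
  show ?case unfolding computes_def
    apply (rule callsI, simp, simp add: iht_procs_def descent_body_def)
    apply (rule calls_computes[OF Cons(3)])
    apply simp
    done
qed

lemma computes_squares: "computes 6 (encode_list l) (encode_list (map (\<lambda>a. a * a) l)) (30 * length l + 30)"
proof (induction l)
  case Nil
  show ?case unfolding computes_def
    by (rule callsI) (simp_all add: iht_procs_def squares_body_def)
next
  case (Cons a l)
  show ?case unfolding computes_def
    apply (rule callsI, simp, simp add: iht_procs_def squares_body_def)
    apply (rule calls_computes[OF Cons])
    apply simp
    done
qed

lemma computes_keep:
  "computes 7 (VCons (encode_list l) (VCons (VNum \<tau>) (VNum r))) (encode_list (keep \<tau> r l)) (100 * length l + 100)"
proof (induction l arbitrary: \<tau> r)
  case Nil
  show ?case unfolding computes_def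
    by (rule callsI) (simp_all add: iht_procs_def keep_body_def)
next
  case (Cons a l)
  show ?case unfolding computes_def
    apply (rule callsI, simp, simp add: iht_procs_def keep_body_def)
    apply (auto intro!: calls_computes[OF Cons])
    done
qed

lemma computes_wnorm:
  assumes "length ws = length xs"
  shows "computes 8 (VCons (encode_list ws) (encode_list xs))
    (VNum (sum_list (map (\<lambda>(w, x). w * (x * x)) (zip ws xs)))) (50 * length xs + 50)"
  using assms
proof (induction ws xs rule: list_induct2)
  case Nil
  show ?case unfolding computes_def
    by (rule callsI) (simp_all add: iht_procs_def wnorm_body_def)
next
  case (Cons w ws x xs)
  show ?case unfolding computes_def
    apply (rule callsI, simp, simp add: iht_procs_def wnorm_body_def)
    apply (rule calls_computes[OF Cons(2)])
    apply simp
    done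
qed

lemma computes_reweight:
  assumes "length ws = length xs"
  shows "computes 9 (VCons (encode_list ws) (VCons (encode_list xs) (VCons (VNum c) (VNum N))))
    (encode_list (map (\<lambda>(w, x). if w - c * ((w * x) * (w * x)) / N < 1/2 then 0 else w - c * ((w * x) * (w * x)) / N) (zip ws xs)))
    (100 * length xs + 100)"
  using assms
proof (induction ws xs rule: list_induct2)
  case Nil
  show ?case unfolding computes_def
    by (rule callsI) (simp_all add: iht_procs_def reweight_body_def)
next
  case (Cons w ws x xs)
  show ?case unfolding computes_def
    apply (rule callsI, simp, simp add: iht_procs_def reweight_body_def)
    apply (auto intro!: calls_computes[OF Cons(2)])
    done
qed

end

section \<open>Selection by medians of medians\<close>

lemma length_medians: "3 * length (medians l) \<le> length l" "length l < 3 * length (medians l) + 3"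
  by (induction l rule: medians.induct) auto

lemma set_medians: "set (medians l) \<subseteq> set l"
  by (induction l rule: medians.induct) auto

text \<open>A median is \<ge> p only if at least two of its three entries are, hence the factor
  2.\<close>

lemma count_ge_medians: "2 * length (filter (\<lambda>x. p \<le> x) (medians l)) \<le> length (filter (\<lambda>x. p \<le> x) l)"
  by (induction l rule: medians.induct) auto

lemma count_le_medians: "2 * length (filter (\<lambda>x. x \<le> p) (medians l)) \<le> length (filter (\<lambda>x. x \<le> p) l)"
  by (induction l rule: medians.induct) auto

text \<open>Position \<open>k\<close> from the largest entry, in a form that tolerates ties. A real
  \<open>k\<close> acts like its ceiling, so half a length may serve as a rank without
  rounding.\<close>

definition has_rank :: "real list \<Rightarrow> real \<Rightarrow> real \<Rightarrow> bool" where
  "has_rank l k \<tau> \<longleftrightarrow> \<tau> \<in> set l \<and> real (length (filter (\<lambda>x. \<tau> < x) l)) < k \<and>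
     k \<le> real (length (filter (\<lambda>x. \<tau> \<le> x) l))"

lemma length_filter_less_compl:
  "length (filter (\<lambda>x. x < p) l) + length (filter (\<lambda>x. p \<le> x) l) = length (l :: real list)"
  "length (filter (\<lambda>x. p < x) l) + length (filter (\<lambda>x. x \<le> p) l) = length l"
  by (induction l) auto

text \<open>Each of the two rounds of medians doubles a count, so the half of \<open>M\<close> on
  either side of \<open>p\<close> accounts for at least twice the length of \<open>M\<close> among
  the entries of \<open>l\<close>.\<close>

lemma pivot_discards:
  fixes l :: "real list"
  defines "M \<equiv> medians (medians l)"
  assumes "has_rank M (real (length M) / 2) p"
  shows "length (filter (\<lambda>x. x < p) l) + 2 * length M \<le> length l"
    "length (filter (\<lambda>x. p < x) l) + 2 * length M \<le> length l"
proof -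
  have "4 * length (filter (\<lambda>x. p \<le> x) M) \<le> length (filter (\<lambda>x. p \<le> x) l)"
    "4 * length (filter (\<lambda>x. x \<le> p) M) \<le> length (filter (\<lambda>x. x \<le> p) l)"
    using count_ge_medians[of p l] count_ge_medians[of p "medians l"]
      count_le_medians[of p l] count_le_medians[of p "medians l"] unfolding M_def by linarith+
  moreover have "length M \<le> 2 * length (filter (\<lambda>x. p \<le> x) M)" "length M \<le> 2 * length (filter (\<lambda>x. x \<le> p) M)"
    using assms(2) length_filter_less_compl(2)[of p M] unfolding has_rank_def by linarith+
  ultimately show "length (filter (\<lambda>x. x < p) l) + 2 * length M \<le> length l"
    "length (filter (\<lambda>x. p < x) l) + 2 * length M \<le> length l"
    using length_filter_less_compl[of p l] by linarith+
qed

lemma has_rank_greater: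
  fixes l :: "real list"
  assumes "has_rank (filter (\<lambda>x. p < x) l) k \<tau>"
  shows "has_rank l k \<tau>"
proof -
  have "p < \<tau>" using assms by (auto simp: has_rank_def)
  then have "filter (\<lambda>x. \<tau> < x) (filter (\<lambda>x. p < x) l) = filter (\<lambda>x. \<tau> < x) l"
    "filter (\<lambda>x. \<tau> \<le> x) (filter (\<lambda>x. p < x) l) = filter (\<lambda>x. \<tau> \<le> x) l"
    by (auto simp: filter_filter intro!: filter_cong)
  then show ?thesis using assms by (auto simp: has_rank_def)
qed

text \<open>All entries \<ge> p lie above \<tau>, so both counts shift by their number.\<close>

lemma has_rank_less:
  fixes l :: "real list"
  assumes "has_rank (filter (\<lambda>x. x < p) l) (k - real (length (filter (\<lambda>x. p \<le> x) l))) \<tau>"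
  shows "has_rank l k \<tau>"
proof -
  have p: "\<tau> < p" using assms by (auto simp: has_rank_def)
  have "length (filter (\<lambda>x. \<tau> < x) l) = length (filter (\<lambda>x. p \<le> x) l) + length (filter (\<lambda>x. \<tau> < x) (filter (\<lambda>x. x < p) l))"
    "length (filter (\<lambda>x. \<tau> \<le> x) l) = length (filter (\<lambda>x. p \<le> x) l) + length (filter (\<lambda>x. \<tau> \<le> x) (filter (\<lambda>x. x < p) l))"
    using p by (induction l) auto
  then show ?thesis using assms by (auto simp: has_rank_def)
qed

text \<open>With \<open>m\<close> medians of medians of \<open>N\<close> elements, the two recursive calls act on lists of
  length \<open>m\<close> and at most \<open>N - 2 m\<close>, and \<open>N \<le> 17 m\<close> unless \<open>m = 0\<close>.\<close>
lemma computes_select: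
  assumes "0 < k" "k \<le> real (length l)"
  shows "\<exists>\<tau>. has_rank l k \<tau> \<and>
    computes n f g 4 (VCons (encode_list l) (VNum k)) (VNum \<tau>) (17000 * length l)"
  using assms
proof (induction l arbitrary: k rule: length_induct)
  case (1 l)
  define M where "M = medians (medians l)"
  have IH: "\<exists>\<tau>. has_rank l' k' \<tau> \<and>
      computes n f g 4 (VCons (encode_list l') (VNum k')) (VNum \<tau>) (17000 * length l')"
    if "length l' < length l" "0 < k'" "k' \<le> real (length l')" for l' k'
    using 1(1) that by blast
  have l: "l \<noteq> []" using 1 by auto
  then have l0: "1 \<le> length l" by (cases l) auto
  have M: "9 * length M \<le> length l" "length l \<le> 9 * length M + 8"
    using length_medians[of l] length_medians[of "medians l"] unfolding M_def by linarith+
  define p_ok where "p_ok p \<longleftrightarrow> (if M = [] then p = hd l else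
    computes n f g 4 (VCons (encode_list M) (VNum (real (length M) / 2))) (VNum p) (17000 * length M))" for p
  obtain p where p: "p \<in> set l" "length (filter (\<lambda>x. x < p) l) + 2 * length M \<le> length l"
    "length (filter (\<lambda>x. p < x) l) + 2 * length M \<le> length l" "p_ok p"
  proof (cases "M = []")
    case True
    then show thesis using that[of "hd l"] l by (simp add: p_ok_def)
  next
    case False
    then have "length M < length l" "0 < real (length M) / 2" "real (length M) / 2 \<le> real (length M)"
      using M(1) length_greater_0_conv[of M] l0 by linarith+
    from IH[OF this] obtain p where p: "has_rank M (real (length M) / 2) p"
      "computes n f g 4 (VCons (encode_list M) (VNum (real (length M) / 2))) (VNum p) (17000 * length M)" by blast
    have "p \<in> set l" using p(1) set_medians[of l] set_medians[of "medians l"] by (auto simp: has_rank_def M_def)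
    then show thesis using that[of p] pivot_discards[of l p] p False by (simp add: p_ok_def M_def)
  qed
  define G where "G = filter (\<lambda>x. p < x) l"
  define L where "L = filter (\<lambda>x. x < p) l"
  have lens: "length G < length l" "length L < length l"
    using p(1) length_filter_less[of p l] by (auto simp: G_def L_def intro!: length_filter_less)
  have compl: "real (length (filter (\<lambda>x. p \<le> x) l)) = real (length l) - real (length L)"
    using length_filter_less_compl(1)[of p l] by (simp add: L_def)
  \<comment> \<open>The budget for \<open>recurse_expr\<close>. With N and m the lengths of
    \<open>l\<close> and \<open>M\<close>, a recursive list is shorter than \<open>l\<close> by at
    least 2 m, and by at least 1 since it omits the pivot. If m > 0, finding the pivot takes 17000 m
    of the 34000 m saved, and the overhead 380 N + 600 is at most 7060 m because N \<le> 17
    m.\<close>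
  define B where "B = 17000 * (length l - (if M = [] then 1 else 2 * length M)) + 200 * length l + 300"
  have rec: "17000 * length G \<le> 17000 * (length l - (if M = [] then 1 else 2 * length M))"
    "17000 * length L \<le> 17000 * (length l - (if M = [] then 1 else 2 * length M))"
    using p(2,3) lens by (auto simp: G_def L_def)
  note greater = calls_computes[OF computes_greater[of n f g p l, folded G_def]]
    and less = calls_computes[OF computes_less[of n f g p l, folded L_def]]
  \<comment> \<open>Stated for every continuation and every leftover argument, so that it applies
    after either way of obtaining the pivot.\<close>
  have "\<exists>\<tau>. has_rank l k \<tau> \<and> (\<forall>Q arg. (\<forall>t\<le>B. Q (VNum \<tau>) 0 0 t) \<longrightarrow>
     wp n f g recurse_expr [VNum p, encode_list M, VNum k, encode_list l, arg] Q)"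
  proof (cases "real (length G) < k")
    case False
    then obtain \<tau> where \<tau>: "has_rank G k \<tau>"
      "computes n f g 4 (VCons (encode_list G) (VNum k)) (VNum \<tau>) (17000 * length G)"
      using IH[OF lens(1) 1(2)] by auto
    have "wp n f g recurse_expr [VNum p, encode_list M, VNum k, encode_list l, arg] Q"
      if Q: "\<forall>t\<le>B. Q (VNum \<tau>) 0 0 t" for Q arg
      unfolding recurse_expr_def
      apply simp
      apply (rule greater; simp?)
      apply (rule calls_computes[OF computes_len]; (simp add: False)?)
      apply (rule calls_computes[OF \<tau>(2)]; simp?)
      apply (rule Q[rule_format])
      using rec lens unfolding B_def
      apply linarith
      done
    then show ?thesis using \<tau>(1) has_rank_greater unfolding G_def by blast
  next
    case True
    define k' where "k' = k - (real (length l) - real (length L))"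
    show ?thesis
    proof (cases "real (length l) - real (length L) < k")
      case e: True
      have k': "k' = k - real (length (filter (\<lambda>x. p \<le> x) l))" using compl by (simp add: k'_def)
      from e have "0 < k'" "k' \<le> real (length L)" using 1(3) by (auto simp: k'_def)
      from IH[OF lens(2) this] obtain \<tau> where \<tau>: "has_rank L k' \<tau>"
        "computes n f g 4 (VCons (encode_list L) (VNum k')) (VNum \<tau>) (17000 * length L)" by blast
      have "wp n f g recurse_expr [VNum p, encode_list M, VNum k, encode_list l, arg] Q"
        if Q: "\<forall>t\<le>B. Q (VNum \<tau>) 0 0 t" for Q arg
        unfolding recurse_expr_def
        apply simp
        apply (rule greater; simp?)
        apply (rule calls_computes[OF computes_len]; (simp add: True)?)
        apply (rule less; simp?)
        apply (rule calls_computes[OF computes_len]; simp?)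
        apply (rule calls_computes[OF computes_len]; (simp add: e k'_def[symmetric])?)
        apply (rule calls_computes[OF \<tau>(2)]; simp?)
        apply (rule Q[rule_format])
        using rec lens unfolding B_def
        apply linarith
        done
      moreover have "has_rank l k \<tau>" using \<tau>(1) unfolding k' L_def by (rule has_rank_less)
      ultimately show ?thesis by blast
    next
      case e: False
      have "wp n f g recurse_expr [VNum p, encode_list M, VNum k, encode_list l, arg] Q"
        if Q: "\<forall>t\<le>B. Q (VNum p) 0 0 t" for Q arg
        unfolding recurse_expr_def
        apply simp
        apply (rule greater; simp?)
        apply (rule calls_computes[OF computes_len]; (simp add: True)?)
        apply (rule less; simp?)
        apply (rule calls_computes[OF computes_len]; simp?)
        apply (rule calls_computes[OF computes_len]; (simp add: e)?)
        apply (rule Q[rule_format])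
        using lens unfolding B_def
        apply linarith
        done
      moreover have "has_rank l k p"
        using True e p(1) compl by (simp add: has_rank_def G_def)
      ultimately show ?thesis by blast
    qed
  qed
  then obtain \<tau> where \<tau>: "has_rank l k \<tau>" "\<And>Q arg. (\<And>t. t \<le> B \<Longrightarrow> Q (VNum \<tau>) 0 0 t) \<Longrightarrow>
     wp n f g recurse_expr [VNum p, encode_list M, VNum k, encode_list l, arg] Q" by blast
  have "computes n f g 4 (VCons (encode_list l) (VNum k)) (VNum \<tau>) (17000 * length l)"
  proof (cases "M = []")
    case True
    have hd: "encode_list l = VCons (VNum p) (encode_list (tl l))"
      using l p(4) True by (cases l) (auto simp: p_ok_def)
    have "length l \<le> 8" using M(2) True by simp
    then have B: "B + (80 * length l + 200) \<le> 17000 * length l" using l0 True unfolding B_def by simp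
    show ?thesis unfolding computes_def
      apply (rule callsI, simp, simp add: iht_procs_def select_body_def)
      apply (rule calls_computes[OF computes_medians]; simp?)
      apply (rule calls_computes[OF computes_medians]; (simp add: M_def[symmetric] True)?)
      \<comment> \<open>The head of \<open>l\<close> is exposed to read off the pivot and folded
        back afterwards, since the execution of \<open>recurse_expr\<close> is stated for
        \<open>encode_list l\<close>.\<close>
      apply (simp add: hd)
      apply (simp only: hd[symmetric])
      apply (rule \<tau>(2)[unfolded True, simplified])
      apply simp
      using B length_medians(1)[of l]
      apply linarith
      done
  next
    case False
    then have "1 \<le> length M" by (cases M) auto
    then have B: "B + 17000 * length M + (180 * length l + 300) \<le> 17000 * length l"
      using M False unfolding B_def by simp
    have p': "computes n f g 4 (VCons (encode_list M) (VNum (real (length M) / 2))) (VNum p) (17000 * length M)"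
      using p(4) False by (simp add: p_ok_def)
    show ?thesis unfolding computes_def
      apply (rule callsI, simp, simp add: iht_procs_def select_body_def)
      apply (rule calls_computes[OF computes_medians]; simp?)
      apply (rule calls_computes[OF computes_medians]; (simp add: M_def[symmetric] False)?)
      apply (rule calls_computes[OF computes_len]; simp?)
      apply (rule calls_computes[OF p']; simp?)
      apply (rule \<tau>(2))
      apply simp
      using B length_medians(1)[of l] M
      apply linarith
      done
  qed
  then show ?case using \<tau>(1) by blast
qed

section \<open>Applying the threshold in the presence of ties\<close>

text \<open>The set of kept positions grows along the list: a dropped head shifts it, a kept head
  shifts it and adds position 0. At most \<open>m\<close> ties are kept, fewer if there are not that
  many.\<close>

lemma keep_selects:
  "\<exists>S\<subseteq>{..<length l}. keep \<tau> (real m) l = map (\<lambda>i. if i \<in> S then l ! i else 0) [0..<length l] \<and>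
     card S = length (filter (\<lambda>x. \<tau> < x * x) l) + min m (length (filter (\<lambda>x. x * x = \<tau>) l)) \<and>
     (\<forall>i<length l. \<tau> < l ! i * l ! i \<longrightarrow> i \<in> S) \<and> (\<forall>i\<in>S. \<tau> \<le> l ! i * l ! i)"
proof (induction l arbitrary: m)
  case Nil
  then show ?case by simp
next
  case (Cons h l)
  have shift: "map (\<lambda>i. if i \<in> S' then (h # l) ! i else 0) [0..<length (h # l)]
     = (if 0 \<in> S' then h else 0) # map (\<lambda>i. if Suc i \<in> S' then l ! i else 0) [0..<length l]" for S'
    unfolding length_Cons by (subst map_upt_Suc) simp
  have fin: "finite S" if "S \<subseteq> {..<length l}" for S using that finite_subset by blast
  have skip: ?case if "\<not> \<tau> < h * h" "h * h < \<tau> \<or> m = 0"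
  proof -
    obtain S where S: "S \<subseteq> {..<length l}" "keep \<tau> (real m) l = map (\<lambda>i. if i \<in> S then l ! i else 0) [0..<length l]"
      "card S = length (filter (\<lambda>x. \<tau> < x * x) l) + min m (length (filter (\<lambda>x. x * x = \<tau>) l))"
      "\<forall>i<length l. \<tau> < l ! i * l ! i \<longrightarrow> i \<in> S" "\<forall>i\<in>S. \<tau> \<le> l ! i * l ! i"
      using Cons[of m] by blast
    have e: "map (\<lambda>i. if i \<in> Suc ` S then (h # l) ! i else 0) [0..<length (h # l)]
      = 0 # map (\<lambda>i. if i \<in> S then l ! i else 0) [0..<length l]"
      unfolding shift by (simp add: inj_image_mem_iff)
    have k: "keep \<tau> (real m) (h # l) = 0 # keep \<tau> (real m) l" using that by auto
    show ?thesis
      unfolding k S(2)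
      by (intro exI[of _ "Suc ` S"] conjI, use S in force, rule e[symmetric])
        (use that S in \<open>auto simp: card_image less_Suc_eq_0_disj\<close>)
  qed
  \<comment> \<open>\<open>m'\<close> is the quota left for the tail: unchanged if the head is above
    the threshold, one less if it is a tie.\<close>
  have take: ?case if "\<tau> < h * h \<and> m' = m \<or> \<tau> = h * h \<and> m = Suc m'" for m'
  proof -
    obtain S where S: "S \<subseteq> {..<length l}" "keep \<tau> (real m') l = map (\<lambda>i. if i \<in> S then l ! i else 0) [0..<length l]"
      "card S = length (filter (\<lambda>x. \<tau> < x * x) l) + min m' (length (filter (\<lambda>x. x * x = \<tau>) l))"
      "\<forall>i<length l. \<tau> < l ! i * l ! i \<longrightarrow> i \<in> S" "\<forall>i\<in>S. \<tau> \<le> l ! i * l ! i"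
      using Cons[of m'] by blast
    have e: "map (\<lambda>i. if i \<in> insert 0 (Suc ` S) then (h # l) ! i else 0) [0..<length (h # l)]
      = h # map (\<lambda>i. if i \<in> S then l ! i else 0) [0..<length l]"
      unfolding shift by (simp add: inj_image_mem_iff)
    have k: "keep \<tau> (real m) (h # l) = h # keep \<tau> (real m') l" using that by auto
    show ?thesis
      unfolding k S(2)
      by (intro exI[of _ "insert 0 (Suc ` S)"] conjI, use S in force, rule e[symmetric])
        (use that S fin[OF S(1)] in \<open>auto simp: card_image card_insert_if less_Suc_eq_0_disj\<close>)
  qed
  show ?case
  proof (cases "\<not> \<tau> < h * h \<and> (h * h < \<tau> \<or> m = 0)")
    case True
    then show ?thesis using skip by blast
  next
    case False
    then show ?thesis using take[of m] take[of "m - 1"] by (cases m) force+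
  qed
qed

section \<open>Cost of an iteration\<close>

lemma encode_list_inject [simp]: "encode_list l = encode_list l' \<longleftrightarrow> l = l'"
proof (induction l arbitrary: l')
  case Nil then show ?case by (cases l') auto
next
  case (Cons a l) then show ?case by (cases l') auto
qed

lemma encode_vec_inject [simp]: "encode_vec x = encode_vec y \<longleftrightarrow> x = y"
  by (metis encode_vec_list encode_list_inject vec_list)

text \<open>Monotone in all three bounds, so that the bindings of the main program can be verified
  one at a time and their costs added.\<close>

definition yields ::
  "nat \<Rightarrow> (real vec \<Rightarrow> real) \<Rightarrow> (real vec \<Rightarrow> real vec) \<Rightarrow> expr \<Rightarrow> val list \<Rightarrow> val \<Rightarrow> nat \<Rightarrow> nat \<Rightarrow> nat \<Rightarrow> bool" where
  "yields n f g e env v p q t \<longleftrightarrow>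
     (\<exists>p' q' t'. p' \<le> p \<and> q' \<le> q \<and> t' \<le> t \<and> exec iht_procs n f g env e v p' q' t')"

lemma yieldsI:
  assumes "wp n f g e env (\<lambda>v' p' q' t'. v' = v \<and> p' \<le> p \<and> q' \<le> q \<and> t' \<le> t)"
  shows "yields n f g e env v p q t"
  using wp_sound[OF assms] unfolding yields_def by blast

lemma yields_LetE:
  assumes "yields n f g e1 env u p1 q1 t1" "yields n f g e2 (u # env) v p2 q2 t2"
  shows "yields n f g (LetE e1 e2) env v (p1 + p2) (q1 + q2) (t1 + t2 + 1)"
proof -
  obtain p1' q1' t1' where 1: "p1' \<le> p1" "q1' \<le> q1" "t1' \<le> t1" "exec iht_procs n f g env e1 u p1' q1' t1'"
    using assms(1) unfolding yields_def by blast
  obtain p2' q2' t2' where 2: "p2' \<le> p2" "q2' \<le> q2" "t2' \<le> t2" "exec iht_procs n f g (u # env) e2 v p2' q2' t2'"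
    using assms(2) unfolding yields_def by blast
  from exec.LetE[OF 1(4) 2(4)] show ?thesis
    unfolding yields_def using 1(1-3) 2(1-3) by (meson add_le_mono le_refl)
qed

lemma map_zip_list_of_vec:
  assumes "x \<in> carrier_vec n" "w \<in> carrier_vec n"
  shows "map F (zip (list_of_vec w) (list_of_vec x)) = map (\<lambda>i. F (w $ i, x $ i)) [0..<n]"
  using assms by (intro nth_equalityI) (auto simp: list_of_vec_index)

lemma list_of_vec_vec: "list_of_vec (vec n h) = map h [0..<n]"
  by (intro nth_equalityI) (auto simp: list_of_vec_index)

text \<open>By the rank of \<open>\<tau>\<close>, the entries above it are fewer than the number to
  be kept, while those at least \<open>\<tau>\<close> suffice. Hence there are enough ties to fill
  the quota \<open>m\<close>, and exactly the required number of positions is kept.\<close>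

lemma keep_hard_threshold:
  fixes z :: "real vec"
  defines "l \<equiv> list_of_vec z"
  defines "a \<equiv> map (\<lambda>h. h * h) l"
  assumes rank: "has_rank a (real (min (dim_vec z) k)) \<tau>"
    and m: "m = min (dim_vec z) k - length (filter (\<lambda>x. \<tau> < x) a)"
  shows "\<exists>y. hard_threshold k z y \<and> list_of_vec y = keep \<tau> (real m) l"
proof -
  have len: "length l = dim_vec z" and nth: "\<And>i. i < dim_vec z \<Longrightarrow> l ! i = z $ i"
    by (auto simp: l_def list_of_vec_index)
  have gt: "length (filter (\<lambda>x. \<tau> < x) a) = length (filter (\<lambda>x. \<tau> < x * x) l)"
    by (simp add: a_def filter_map o_def)
  have ge: "length (filter (\<lambda>x. \<tau> \<le> x) a) = length (filter (\<lambda>x. \<tau> < x * x) l) + length (filter (\<lambda>x. x * x = \<tau>) l)"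
    unfolding a_def by (induction l) auto
  obtain S where S: "S \<subseteq> {..<dim_vec z}" "keep \<tau> (real m) l = map (\<lambda>i. if i \<in> S then l ! i else 0) [0..<dim_vec z]"
    "card S = length (filter (\<lambda>x. \<tau> < x * x) l) + min m (length (filter (\<lambda>x. x * x = \<tau>) l))"
    "\<And>i. i < dim_vec z \<Longrightarrow> \<tau> < l ! i * l ! i \<Longrightarrow> i \<in> S" "\<And>i. i \<in> S \<Longrightarrow> \<tau> \<le> l ! i * l ! i"
    using keep_selects[of l \<tau> m] unfolding len by blast
  have "card S = min k (dim_vec z)"
    using rank m unfolding S(3) has_rank_def gt ge by linarith
  moreover have "\<bar>z $ j\<bar> \<le> \<bar>z $ i\<bar>" if "i \<in> S" "j \<in> {..<dim_vec z} - S" for i j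
  proof -
    have ij: "i < dim_vec z" "j < dim_vec z" "j \<notin> S" using that S(1) by auto
    then have "l ! j * l ! j \<le> \<tau>" "\<tau> \<le> l ! i * l ! i" using S(4)[of j] S(5)[of i] that(1) by force+
    then have "(z $ j)\<^sup>2 \<le> (z $ i)\<^sup>2" using ij nth by (simp add: power2_eq_square)
    then show ?thesis by (simp add: abs_le_square_iff)
  qed
  ultimately have "hard_threshold k z (vec (dim_vec z) (\<lambda>i. if i \<in> S then z $ i else 0))"
    unfolding hard_threshold_def using S(1) by blast
  moreover have "list_of_vec (vec (dim_vec z) (\<lambda>i. if i \<in> S then z $ i else 0)) = keep \<tau> (real m) l"
    unfolding S(2) list_of_vec_vec using nth by auto
  ultimately show ?thesis by blast
qed

lemma computes_wnorm_sq:
  assumes "x \<in> carrier_vec n" "w \<in> carrier_vec n"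
  shows "computes n f g 8 (VCons (encode_vec w) (encode_vec x)) (VNum (wnorm_sq w x)) (50 * n + 50)"
proof -
  have "sum_list (map (\<lambda>(w, x). w * (x * x)) (zip (list_of_vec w) (list_of_vec x))) = wnorm_sq w x"
    unfolding map_zip_list_of_vec[OF assms] wnorm_sq_def using assms
    by (simp add: sum_list_sum_nth lessThan_atLeast0 power2_eq_square)
  then show ?thesis
    using computes_wnorm[of "list_of_vec w" "list_of_vec x" n f g] assms by (simp add: encode_vec_list)
qed

lemma computes_update_weights:
  assumes "x \<in> carrier_vec n" "w \<in> carrier_vec n" "wnorm_sq w x \<noteq> 0"
  shows "computes n f g 9 (VCons (encode_vec w) (VCons (encode_vec x) (VCons (VNum c) (VNum (wnorm_sq w x)))))
    (encode_vec (update_weights c x w)) (100 * n + 100)"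
proof -
  have "list_of_vec (update_weights c x w) = map (\<lambda>(w', x'). if w' - c * ((w' * x') * (w' * x')) / wnorm_sq w x < 1/2 then 0
     else w' - c * ((w' * x') * (w' * x')) / wnorm_sq w x) (zip (list_of_vec w) (list_of_vec x))"
    unfolding map_zip_list_of_vec[OF assms(1,2)] using assms
    by (intro nth_equalityI) (auto simp: update_weights_def threshold_half_def list_of_vec_index power2_eq_square)
  then show ?thesis
    using computes_reweight[of "list_of_vec w" "list_of_vec x" n f g c "wnorm_sq w x"] assms by (simp add: encode_vec_list)
qed

text \<open>The program breaks ties in its own way, and the \<open>y\<close> that it computes is the
  witness for \<open>riht_step\<close>. The signs of the weights are not restricted, so the weighted
  norm may be negative and is compared with 0 from both sides.\<close>

lemma iteration_cost:
  fixes x w :: "real vec"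
  assumes n: "n \<ge> 1" and x: "x \<in> carrier_vec n" and w: "w \<in> carrier_vec n"
    and gr: "gradient n f x \<in> carrier_vec n" and s': "s' \<ge> 1"
  shows "iteration_cost_le iht_procs iht_main 20000 n f s' \<eta> c x w"
proof -
  let ?g = "gradient n f"
  define z where "z = vec n (\<lambda>i. (1 - 0.5 * w $ i) * x $ i - \<eta> * ?g x $ i)"
  define a where "a = map (\<lambda>h. h * h) (list_of_vec z)"
  define k where "k = min n s'"
  define w' where "w' = update_weights c x w"
  define N where "N = wnorm_sq w x"
  have z: "z \<in> carrier_vec n" by (simp add: z_def)
  have la: "length a = n" by (simp add: a_def z_def)
  have w': "w' \<in> carrier_vec n" using w by (auto simp: w'_def update_weights_def threshold_half_def)
  have "0 < real k" "real k \<le> real (length a)" using n s' by (auto simp: k_def la)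
  from computes_select[OF this] obtain \<tau> where rank: "has_rank a (real k) \<tau>"
    and sel: "computes n f ?g 4 (VCons (encode_list a) (VNum (real k))) (VNum \<tau>) (17000 * n)"
    unfolding la by blast
  define m where "m = k - length (filter (\<lambda>x. \<tau> < x) a)"
  have m: "real m = real k - real (length (filter (\<lambda>x. \<tau> < x) a))"
    using rank by (simp add: has_rank_def m_def)
  have dz: "dim_vec z = n" using z by simp
  obtain y where y: "hard_threshold s' z y" "list_of_vec y = keep \<tau> (real m) (list_of_vec z)"
    using keep_hard_threshold[of z s' \<tau> m] rank m_def unfolding a_def k_def dz by blast
  have yc: "y \<in> carrier_vec n" using y(1) dz by (auto simp: hard_threshold_def)
  define x' where "x' = (if f y + 1 / (4 * \<eta>) * wnorm_sq w' y > f x + 1 / (4 * \<eta>) * wnorm_sq w' x then x else y)"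
  have step: "riht_step n f s' \<eta> c x w x' w'"
    unfolding riht_step_def x'_def w'_def using y(1) unfolding z_def by blast
  have "list_of_vec z = map (\<lambda>(x, w, d). (1 - 0.5 * w) * x - \<eta> * d) (zip (list_of_vec x) (zip (list_of_vec w) (list_of_vec (?g x))))"
    using x w gr by (intro nth_equalityI) (auto simp: z_def list_of_vec_index)
  then have d: "computes n f ?g 5 (VCons (encode_vec x) (VCons (encode_vec w) (VCons (encode_vec (?g x)) (VNum \<eta>))))
      (encode_vec z) (100 * n + 100)"
    using computes_descent[of "list_of_vec x" "list_of_vec w" "list_of_vec (?g x)" n f ?g \<eta>] x w gr by (simp add: encode_vec_list)
  have sq: "computes n f ?g 6 (encode_vec z) (encode_list a) (30 * n + 30)"
    using computes_squares[of n f ?g "list_of_vec z"] z by (simp add: encode_vec_list a_def)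
  have len: "computes n f ?g 0 (encode_list a) (VNum (real n)) (10 * n + 10)"
    using computes_len[of n f ?g a] by (simp add: la)
  have gt: "computes n f ?g 2 (VCons (VNum \<tau>) (encode_list a)) (encode_list (filter (\<lambda>x. \<tau> < x) a)) (30 * n + 30)"
    using computes_greater[of n f ?g \<tau> a] by (simp add: la)
  have kp: "computes n f ?g 7 (VCons (encode_vec z) (VCons (VNum \<tau>) (VNum (real m)))) (encode_vec y) (100 * n + 100)"
    using computes_keep[of n f ?g "list_of_vec z" \<tau> "real m"] z y(2) by (simp add: encode_vec_list)
  note wn = computes_wnorm_sq[OF x w, of f ?g, folded N_def]
  have lf: "length (filter (\<lambda>x. \<tau> < x) a) \<le> n" using length_filter_le[of _ a] la by simp
  let ?e0 = "[encode_vec x, encode_vec w, VNum (real s'), VNum \<eta>, VNum c]"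
  let ?e1 = "encode_vec z # ?e0"
  let ?e2 = "encode_list a # ?e1"
  let ?e3 = "VNum (real n) # ?e2"
  let ?e4 = "VNum (real k) # ?e3"
  let ?e5 = "VNum \<tau> # ?e4"
  let ?e6 = "encode_vec y # ?e5"
  let ?e7 = "VNum N # ?e6"
  let ?e8 = "encode_vec w' # ?e7"
  have s1: "yields n f ?g (Call 5 (ConsE (Var 0) (ConsE (Var 1) (ConsE (EvalGrad (Var 0)) (Var 3))))) ?e0 (encode_vec z) 0 1 (100 * n + 120)"
    apply (rule yieldsI, simp add: x)
    apply (rule calls_computes[OF d]; simp?)
    done
  have s2: "yields n f ?g (Call 6 (Var 0)) ?e1 (encode_list a) 0 0 (30 * n + 50)"
    apply (rule yieldsI, simp)
    apply (rule calls_computes[OF sq]; simp?)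
    done
  have s3: "yields n f ?g (Call 0 (Var 0)) ?e2 (VNum (real n)) 0 0 (10 * n + 20)"
    apply (rule yieldsI, simp)
    apply (rule calls_computes[OF len]; simp?)
    done
  have s4: "yields n f ?g (IfLess (Var 0) (Var 5) (Var 0) (Var 5)) ?e3 (VNum (real k)) 0 0 10"
    by (rule yieldsI) (auto simp: k_def)
  have s5: "yields n f ?g (Call 4 (ConsE (Var 2) (Var 0))) ?e4 (VNum \<tau>) 0 0 (17000 * n + 10)"
    apply (rule yieldsI, simp)
    apply (rule calls_computes[OF sel]; simp?)
    done
  have s6: "yields n f ?g (Call 7 (ConsE (Var 4) (ConsE (Var 0) (Arith Minus (Var 1) (Call 0 (Call 2 (ConsE (Var 0) (Var 3))))))))
     ?e5 (encode_vec y) 0 0 (140 * n + 200)"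
    apply (rule yieldsI, simp)
    apply (rule calls_computes[OF gt]; simp?)
    apply (rule calls_computes[OF computes_len]; (simp add: m[symmetric])?)
    apply (rule calls_computes[OF kp]; simp?)
    using lf apply linarith
    done
  have s7: "yields n f ?g (Call 8 (ConsE (Var 7) (Var 6))) ?e6 (VNum N) 0 0 (50 * n + 60)"
    apply (rule yieldsI, simp)
    apply (rule calls_computes[OF wn]; simp?)
    done
  have s8: "yields n f ?g (IfLess (Var 0) (Lit 0) reweight_expr (IfLess (Lit 0) (Var 0) reweight_expr (Var 8))) ?e7 (encode_vec w') 0 0 (100 * n + 150)"
  proof (cases "N = 0")
    case True
    then have "w' = w" by (simp add: w'_def update_weights_def N_def)
    then show ?thesis using True by (intro yieldsI) simp
  next
    case False
    note up = calls_computes[OF computes_update_weights[OF x w, of f ?g c, folded N_def w'_def, OF False]]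
    have "N < 0 \<or> \<not> N < 0 \<and> 0 < N" using False by auto
    then show ?thesis
    proof (elim disjE conjE)
      assume "N < 0"
      then show ?thesis
        apply (intro yieldsI)
        apply (simp add: reweight_expr_def)
        apply (rule up; simp?)
        done
    next
      assume "\<not> N < 0" "0 < N"
      then show ?thesis
        apply (intro yieldsI)
        apply (simp add: reweight_expr_def)
        apply (rule up; simp?)
        done
    qed
  qed
  note wx = calls_computes[OF computes_wnorm_sq[OF x w', of f ?g]]
    and wy = calls_computes[OF computes_wnorm_sq[OF yc w', of f ?g]]
  have s9: "yields n f ?g (IfLess (objective_expr (Var 8)) (objective_expr (Var 2)) (ConsE (Var 8) (Var 0)) (ConsE (Var 2) (Var 0)))
     ?e8 (VCons (encode_vec x') (encode_vec w')) 2 0 (100 * n + 200)"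
    apply (rule yieldsI, simp add: objective_expr_def x yc)
    apply (rule wx; simp?)
    apply (rule wy; (simp add: x'_def)?)
    done
  have "yields n f ?g iht_main ?e0 (VCons (encode_vec x') (encode_vec w')) (0 + (0 + (0 + (0 + (0 + (0 + (0 + (0 + 2)))))))) (1 + (0 + (0 + (0 + (0 + (0 + (0 + (0 + 0))))))))
     (100 * n + 120 + (30 * n + 50 + (10 * n + 20 + (10 + (17000 * n + 10 + (140 * n + 200 +
       (50 * n + 60 + (100 * n + 150 + (100 * n + 200) + 1) + 1) + 1) + 1) + 1) + 1) + 1) + 1)"
    unfolding iht_main_def
    by (intro yields_LetE[OF s1] yields_LetE[OF s2] yields_LetE[OF s3] yields_LetE[OF s4] yields_LetE[OF s5]
      yields_LetE[OF s6] yields_LetE[OF s7] yields_LetE[OF s8] s9)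
  then obtain p q t where e: "exec iht_procs n f ?g ?e0 iht_main (VCons (encode_vec x') (encode_vec w')) p q t"
    and b: "p \<le> 2" "q \<le> 1" "t \<le> 18000 * n + 1000" unfolding yields_def by fastforce
  \<comment> \<open>As n \<ge> 1, the constant 1000 is absorbed into the linear term. The two
    queries of \<open>f\<close> belong to the acceptance test.\<close>
  have "p \<le> 20000" "q \<le> 20000" "t \<le> 20000 * n" using b n by linarith+
  then show ?thesis unfolding iteration_cost_le_def using e step by blast
qed

section \<open>Convergence and cost combined\<close>

lemma riht_guarantee:
  fixes f :: "real vec \<Rightarrow> real" and x0 xs :: "real vec"
  assumes n: "n \<ge> 1" and df: "vec_differentiable n f" and \<alpha>: "\<alpha> > 0"
    and sm: "smooth n \<beta> f" and sc: "strongly_convex n \<alpha> f"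
    and s: "s \<ge> 1" and xs: "xs \<in> carrier_vec n" "sparse s xs" and \<epsilon>: "\<epsilon> > 0"
    and s': "s' = nat \<lceil>258 * real s * (\<beta> / \<alpha>)\<rceil>"
    and x0: "x0 \<in> carrier_vec n" "sparse s' x0"
    and gap: "gap = f x0 + \<beta> / 2 * (norm2 x0)\<^sup>2 - f xs"
    and T: "T = (if gap \<le> \<epsilon> then 1 else max 1 (nat \<lceil>48 * (\<beta> / \<alpha>) * ln (gap / \<epsilon>)\<rceil>))"
    and c: "c = real s' / (4 * real T)"
  shows "(\<exists>X W. riht_run n f s' (1 / (2 * \<beta>)) c T x0 X W) \<and>
    (\<forall>X W. riht_run n f s' (1 / (2 * \<beta>)) c T x0 X W \<longrightarrow>
      X T \<in> carrier_vec n \<and> sparse s' (X T) \<and> f (X T) \<le> f xs + \<epsilon> \<and>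
    (\<forall>t<T. iteration_cost_le iht_procs iht_main 20000 n f s' (1 / (2 * \<beta>)) c (X t) (W t)))"
proof (intro conjI[OF riht_run_ex] allI impI)
  fix X W
  assume run: "riht_run n f s' (1 / (2 * \<beta>)) c T x0 X W"
  define \<kappa> where "\<kappa> = \<beta> / \<alpha>"
  have \<alpha>\<beta>: "\<alpha> \<le> \<beta>" using strong_convexity_le_smoothness[OF sm sc n] .
  have \<kappa>1: "1 \<le> \<kappa>" using \<alpha> \<alpha>\<beta> by (simp add: \<kappa>_def)
  have s'': "258 * real s * \<kappa> \<le> real s'" unfolding s' \<kappa>_def by linarith
  have "1 \<le> real s * \<kappa>" using s \<kappa>1 mult_mono[of 1 "real s" 1 \<kappa>] by simp
  then have s'1: "s' \<ge> 1" using s'' by linarith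
  have T1: "T \<ge> 1" by (simp add: T)
  have T': "48 * \<kappa> * ln (gap / \<epsilon>) \<le> real T" if "gap > \<epsilon>"
    using that unfolding T \<kappa>_def by (simp add: not_le[symmetric]) linarith
  have inv: "X t \<in> carrier_vec n" "sparse s' (X t)" "admissible_weights n (W t)" if "t \<le> T" for t
    using riht_run_invariant[OF sm sc x0(1) xs(1) \<alpha> \<alpha>\<beta> run x0(2) xs(2) s \<kappa>_def s'' T1 c refl refl that] by auto
  have "f (X T) \<le> f xs + \<epsilon>"
    by (rule riht_run_converges[OF sm sc x0(1) xs(1) \<alpha> \<alpha>\<beta> run x0(2) xs(2) s \<kappa>_def s'' T1 c gap \<epsilon> T'])
  moreover have "iteration_cost_le iht_procs iht_main 20000 n f s' (1 / (2 * \<beta>)) c (X t) (W t)" if "t < T" for t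
    using inv[of t] that by (intro iteration_cost n s'1 gradient_carrier df) (auto simp: admissible_weights_def)
  ultimately show "X T \<in> carrier_vec n \<and> sparse s' (X T) \<and> f (X T) \<le> f xs + \<epsilon> \<and>
    (\<forall>t<T. iteration_cost_le iht_procs iht_main 20000 n f s' (1 / (2 * \<beta>)) c (X t) (W t))"
    using inv[of T] by blast
qed

theorem theorem1p1:
  shows "\<exists>(C1::real) (C2::real) (P :: expr list) (main :: expr) (K :: nat). C1 > 0 \<and> C2 > 0 \<and>
    (\<forall>(n::nat) (f :: real vec \<Rightarrow> real) (\<alpha>::real) (\<beta>::real) (s::nat) (xstar :: real vec) (\<epsilon>::real).
      n \<ge> 1 \<and> vec_differentiable n f \<and> vec_convex n f \<and>
      \<alpha> > 0 \<and> \<beta> > 0 \<and> smooth n \<beta> f \<and> strongly_convex n \<alpha> f \<and>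
      s \<ge> 1 \<and> xstar \<in> carrier_vec n \<and> sparse s xstar \<and> \<epsilon> > 0 \<longrightarrow>
      (let \<kappa> = \<beta> / \<alpha>;
           s' = nat \<lceil>C1 * real s * \<kappa>\<rceil>
       in \<forall>x0 \<in> carrier_vec n. sparse s' x0 \<longrightarrow>
         (let gap = f x0 + \<beta> / 2 * (norm2 x0)\<^sup>2 - f xstar;
              T = (if gap \<le> \<epsilon> then 1 else max 1 (nat \<lceil>C2 * \<kappa> * ln (gap / \<epsilon>)\<rceil>));
              \<eta> = 1 / (2 * \<beta>);
              c = real s' / (4 * real T)
          in (\<exists>X W. riht_run n f s' \<eta> c T x0 X W) \<and>
             (\<forall>X W. riht_run n f s' \<eta> c T x0 X W \<longrightarrow>
                X T \<in> carrier_vec n \<and> sparse s' (X T) \<and> f (X T) \<le> f xstar + \<epsilon> \<and>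
                (\<forall>t<T. iteration_cost_le P main K n f s' \<eta> c (X t) (W t))))))"
  unfolding Let_def
  apply (rule exI[of _ 258], rule exI[of _ 48], rule exI[of _ iht_procs], rule exI[of _ iht_main], rule exI[of _ 20000])
  apply (rule conjI, simp, rule conjI, simp)
  apply (intro allI impI ballI)
  apply (elim conjE)
  apply (rule riht_guarantee[OF _ _ _ _ _ _ _ _ _ refl _ _ refl refl refl]; assumption)
  done

end
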